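(* Let $N\ge 1$, $T\in[0,\infty)$ and $x_0\in\mathbb{R}^N$. For all $i,j\in\{1,\dots,N\}$ let $p_{ij}:\mathbb{R}^N\to[0,1]$ be globally Lipschitz continuous. Let $A\in[0,1]^{N\times N}$ be a fixed matrix with $A_{ii}=1$ for all $i$, and let $k_i=\sum_{\ell=1}^N A_{i\ell}$. For $h>0$ let $X^h$ be the trajectory on $[0,T]$ of the agent-based model with selection by node degree (described in the context), with timestep $h$, initial opinions $x_0$ and update distance $\mu^h=Nh$. Then, as $h\to0$, $X^h$ converges in distribution in $D([0,T],\mathbb{R}^N)$ to the solution $X=(X(t):t\in[0,T])$ of $$\frac{dX_i}{dt}=\frac1{k_i}\sum_{j=1}^N A_{ij}\,p_{ij}(X)\,(X_j-X_i),\quad i=1,\dots,N,\qquad X(0)=x_0 .$$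
   Context: Agent-based model with timestep $h>0$ and selection by node degree: the opinions $x(t)\in\mathbb{R}^N$ evolve at times $t=0,h,2h,\dots$ as a discrete-time Markov chain with $x(0)=x_0$. At each timestep an individual $i$ is chosen uniformly at random from $\{1,\dots,N\}$, independently of the past; then a second individual $j\in\{1,\dots,N\}$ is selected with probability $A_{ij}/k_i$ ($j=i$ allowed). Then, given the current state $x=x(t)$, $$x_i(t+h)=\begin{cases}x_i(t)+\mu^h\,(x_j(t)-x_i(t)) & \text{with probability } p_{ij}(x),\\ x_i(t) & \text{with probability } 1-p_{ij}(x),\end{cases}$$ and all other coordinates are unchanged. The trajectory $X^h=(X^h_t)_{t\in[0,T]}$ is the piecewise constant process $X^h_t=x(h\lfloor t/h\rfloor)$, viewed as a random element of the Skorokhod space $D([0,T],\mathbb{R}^N)$ of càdlàg functions. Convergence in distribution means $\mathbb{E}[f(X^h)]\to\mathbb{E}[f(X)]$ for every bounded continuous real-valued $f$ on $D([0,T],\mathbb{R}^N)$. *)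

theory Defs
  imports "HOL-Probability.Probability"
begin

section \<open>The Skorokhod space $D([0,T],E)$\<close>

definition cadlag :: "real \<Rightarrow> (real \<Rightarrow> 'a::metric_space) \<Rightarrow> bool" where
  "cadlag T f \<longleftrightarrow>
     (\<forall>t\<in>{0..<T}. (f \<longlongrightarrow> f t) (at_right t)) \<and>
     (\<forall>t\<in>{0<..T}. \<exists>l. (f \<longlongrightarrow> l) (at_left t))"

text \<open>Functions on $[0,T]$ are total functions with the fixed value \<^term>\<open>undefined\<close>
  outside of $[0,T]$, so that equality of elements is equality on $[0,T]$.\<close>

definition skorokhod_space :: "real \<Rightarrow> (real \<Rightarrow> 'a::metric_space) set" where
  "skorokhod_space T = {f \<in> extensional {0..T}. cadlag T f}"

definition time_changes :: "real \<Rightarrow> (real \<Rightarrow> real) set" where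
  "time_changes T =
     {\<tau>. continuous_on {0..T} \<tau> \<and> strict_mono_on {0..T} \<tau> \<and> \<tau> ` {0..T} = {0..T}}"

text \<open>The value 0 outside of the space only serves \<^locale>\<open>Metric_space\<close>, which requires
  nonnegativity on the whole type.\<close>

definition skorokhod_dist ::
  "real \<Rightarrow> (real \<Rightarrow> 'a::metric_space) \<Rightarrow> (real \<Rightarrow> 'a) \<Rightarrow> real" where
  "skorokhod_dist T f g =
     (if f \<in> skorokhod_space T \<and> g \<in> skorokhod_space T
      then Inf {\<epsilon>. 0 < \<epsilon> \<and> (\<exists>\<tau>\<in>time_changes T.
             \<forall>t\<in>{0..T}. \<bar>\<tau> t - t\<bar> \<le> \<epsilon> \<and> dist (f (\<tau> t)) (g t) \<le> \<epsilon>)}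
      else 0)"

definition skorokhod_topology :: "real \<Rightarrow> (real \<Rightarrow> 'a::metric_space) topology" where
  "skorokhod_topology T = Metric_space.mtopology (skorokhod_space T) (skorokhod_dist T)"

lemma cadlag_bounded:
  assumes "cadlag T f"
  shows "bounded (f ` {0..T})"
proof (cases "0 \<le> T")
  case True
  define P where "P a b \<longleftrightarrow> bounded (f ` ({a..b} \<inter> {0..T}))" for a b
  have "P 0 T"
    using True
  proof (induction rule: Bolzano)
    case (trans a b c)
    have "{a..c} \<inter> {0..T} \<subseteq> ({a..b} \<inter> {0..T}) \<union> ({b..c} \<inter> {0..T})"
      by auto
    then have "f ` ({a..c} \<inter> {0..T}) \<subseteq> f ` ({a..b} \<inter> {0..T}) \<union> f ` ({b..c} \<inter> {0..T})"
      by (metis image_Un image_mono)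
    then show ?case
      using trans unfolding P_def by (meson bounded_Un bounded_subset)
  next
    case (local x)
    have right: "\<exists>d>0. \<exists>c. \<forall>s. x < s \<and> s < x + d \<and> s \<le> T \<longrightarrow> dist (f s) c < 1"
    proof (cases "x < T")
      case True
      then have "(f \<longlongrightarrow> f x) (at_right x)"
        using assms local by (auto simp: cadlag_def)
      then have "eventually (\<lambda>s. dist (f s) (f x) < 1) (at_right x)"
        by (rule tendstoD) simp
      then obtain b where b: "b > x" "\<And>s. x < s \<Longrightarrow> s < b \<Longrightarrow> dist (f s) (f x) < 1"
        by (auto simp: eventually_at_right_field)
      then show ?thesis
        by (intro exI[of _ "b - x"] conjI exI[of _ "f x"]) auto
    qed (auto intro!: exI[of _ 1])
    have left: "\<exists>d>0. \<exists>c. \<forall>s. x - d < s \<and> s < x \<and> 0 \<le> s \<longrightarrow> dist (f s) c < 1"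
    proof (cases "0 < x")
      case True
      then have "x \<in> {0<..T}" using local by auto
      then obtain l where "(f \<longlongrightarrow> l) (at_left x)"
        using assms unfolding cadlag_def by blast
      then have "eventually (\<lambda>s. dist (f s) l < 1) (at_left x)"
        by (rule tendstoD) simp
      then obtain b where b: "b < x" "\<And>s. b < s \<Longrightarrow> s < x \<Longrightarrow> dist (f s) l < 1"
        by (auto simp: eventually_at_left_field)
      then show ?thesis
        by (intro exI[of _ "x - b"] conjI exI[of _ l]) auto
    qed (auto intro!: exI[of _ 1])
    obtain d1 c1 where 1: "d1 > 0"
      "\<And>s. x < s \<Longrightarrow> s < x + d1 \<Longrightarrow> s \<le> T \<Longrightarrow> dist (f s) c1 < 1"
      using right by blast
    obtain d2 c2 where 2: "d2 > 0"
      "\<And>s. x - d2 < s \<Longrightarrow> s < x \<Longrightarrow> 0 \<le> s \<Longrightarrow> dist (f s) c2 < 1"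
      using left by blast
    have "P a b" if "a \<le> x" "x \<le> b" "b - a < min d1 d2" for a b
    proof -
      have "f ` ({a..b} \<inter> {0..T}) \<subseteq> ball c1 1 \<union> ball c2 1 \<union> {f x}"
      proof
        fix y assume "y \<in> f ` ({a..b} \<inter> {0..T})"
        then obtain s where s: "y = f s" "a \<le> s" "s \<le> b" "0 \<le> s" "s \<le> T" by auto
        consider "s < x" | "s = x" | "s > x" by linarith
        then show "y \<in> ball c1 1 \<union> ball c2 1 \<union> {f x}"
          using 1(2)[of s] 2(2)[of s] s that by cases (auto simp: dist_commute)
      qed
      then show ?thesis
        unfolding P_def by (rule bounded_subset[rotated]) auto
    qed
    then show ?case
      using 1(1) 2(1) by (intro exI[of _ "min d1 d2"]) auto
  qed
  then show ?thesis by (simp add: P_def)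
qed auto

lemma id_time_change: "(\<lambda>t. t) \<in> time_changes T"
  by (auto simp: time_changes_def strict_mono_on_def)

lemma time_change_mem: "\<tau> \<in> time_changes T \<Longrightarrow> t \<in> {0..T} \<Longrightarrow> \<tau> t \<in> {0..T}"
  by (auto simp: time_changes_def)

lemma comp_time_change:
  assumes "\<sigma> \<in> time_changes T" "\<tau> \<in> time_changes T"
  shows "(\<lambda>t. \<sigma> (\<tau> t)) \<in> time_changes T"
proof -
  have "(\<lambda>t. \<sigma> (\<tau> t)) ` {0..T} = \<sigma> ` (\<tau> ` {0..T})" by auto
  moreover have "continuous_on {0..T} (\<lambda>t. \<sigma> (\<tau> t))"
    using assms by (auto simp: time_changes_def intro!: continuous_on_compose2[of "{0..T}" \<sigma>])
  ultimately show ?thesis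
    using assms time_change_mem[OF assms(2)]
    by (auto simp: time_changes_def strict_mono_on_def)
qed

lemma inv_time_change:
  assumes "\<tau> \<in> time_changes T"
  shows "\<exists>\<sigma>\<in>time_changes T. \<forall>t\<in>{0..T}. \<tau> (\<sigma> t) = t \<and> \<sigma> (\<tau> t) = t"
proof
  have \<tau>: "continuous_on {0..T} \<tau>" "strict_mono_on {0..T} \<tau>" "\<tau> ` {0..T} = {0..T}"
    using assms by (auto simp: time_changes_def)
  have inj: "inj_on \<tau> {0..T}"
    using \<tau>(2) by (rule strict_mono_on_imp_inj_on)
  define \<sigma> where "\<sigma> = inv_into {0..T} \<tau>"
  show inv: "\<forall>t\<in>{0..T}. \<tau> (\<sigma> t) = t \<and> \<sigma> (\<tau> t) = t"
    unfolding \<sigma>_def using \<tau>(3) inj by (metis f_inv_into_f inv_into_f_f)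
  have cont: "continuous_on {0..T} \<sigma>"
    using continuous_on_inv[of "{0..T}" \<tau> \<sigma>] \<tau> inv by auto
  have im: "\<sigma> ` {0..T} = {0..T}"
    unfolding \<sigma>_def using \<tau>(3) inj
    by (metis bij_betw_def bij_betw_inv_into)
  have "\<sigma> r < \<sigma> s" if "r \<in> {0..T}" "s \<in> {0..T}" "r < s" for r s
  proof (rule ccontr)
    assume "\<not> \<sigma> r < \<sigma> s"
    moreover have "\<sigma> r \<in> {0..T}" "\<sigma> s \<in> {0..T}" using that im by auto
    ultimately have "\<tau> (\<sigma> s) \<le> \<tau> (\<sigma> r)"
      using \<tau>(2) by (metis linorder_not_le order.order_iff_strict strict_mono_onD)
    then show False using inv that by auto
  qed
  then show "\<sigma> \<in> time_changes T"
    using cont im by (auto simp: time_changes_def strict_mono_on_def)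
qed

definition skorokhod_close ::
  "real \<Rightarrow> (real \<Rightarrow> 'a::metric_space) \<Rightarrow> (real \<Rightarrow> 'a) \<Rightarrow> real \<Rightarrow> bool" where
  "skorokhod_close T f g \<epsilon> \<longleftrightarrow> 0 < \<epsilon> \<and> (\<exists>\<tau>\<in>time_changes T.
            \<forall>t\<in>{0..T}. \<bar>\<tau> t - t\<bar> \<le> \<epsilon> \<and> dist (f (\<tau> t)) (g t) \<le> \<epsilon>)"

lemma skorokhod_dist_eq:
  assumes "f \<in> skorokhod_space T" "g \<in> skorokhod_space T"
  shows "skorokhod_dist T f g = Inf {\<epsilon>. skorokhod_close T f g \<epsilon>}"
  using assms
  by (simp add: skorokhod_dist_def skorokhod_close_def)

lemma skorokhod_close_sym:
  assumes "skorokhod_close T f g \<epsilon>"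
  shows "skorokhod_close T g f \<epsilon>"
proof -
  obtain \<tau> where \<tau>: "\<tau> \<in> time_changes T"
    "\<And>t. t \<in> {0..T} \<Longrightarrow> \<bar>\<tau> t - t\<bar> \<le> \<epsilon> \<and> dist (f (\<tau> t)) (g t) \<le> \<epsilon>"
    using assms by (auto simp: skorokhod_close_def)
  obtain \<sigma> where \<sigma>: "\<sigma> \<in> time_changes T" "\<forall>t\<in>{0..T}. \<tau> (\<sigma> t) = t \<and> \<sigma> (\<tau> t) = t"
    using inv_time_change[OF \<tau>(1)] by auto
  have "\<bar>\<sigma> t - t\<bar> \<le> \<epsilon> \<and> dist (g (\<sigma> t)) (f t) \<le> \<epsilon>" if "t \<in> {0..T}" for t
    using \<tau>(2)[OF time_change_mem[OF \<sigma>(1) that]] \<sigma>(2) that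
    by (simp add: dist_commute abs_minus_commute)
  then show ?thesis
    using assms \<sigma>(1) unfolding skorokhod_close_def by blast
qed

lemma skorokhod_close_trans:
  assumes "skorokhod_close T f g \<delta>" "skorokhod_close T g k \<epsilon>"
  shows "skorokhod_close T f k (\<delta> + \<epsilon>)"
proof -
  obtain \<sigma> where \<sigma>: "\<sigma> \<in> time_changes T"
    "\<And>t. t \<in> {0..T} \<Longrightarrow> \<bar>\<sigma> t - t\<bar> \<le> \<delta> \<and> dist (f (\<sigma> t)) (g t) \<le> \<delta>"
    using assms(1) by (auto simp: skorokhod_close_def)
  obtain \<tau> where \<tau>: "\<tau> \<in> time_changes T"
    "\<And>t. t \<in> {0..T} \<Longrightarrow> \<bar>\<tau> t - t\<bar> \<le> \<epsilon> \<and> dist (g (\<tau> t)) (k t) \<le> \<epsilon>"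
    using assms(2) by (auto simp: skorokhod_close_def)
  have "\<bar>\<sigma> (\<tau> t) - t\<bar> \<le> \<delta> + \<epsilon> \<and> dist (f (\<sigma> (\<tau> t))) (k t) \<le> \<delta> + \<epsilon>" if "t \<in> {0..T}" for t
    using \<sigma>(2)[OF time_change_mem[OF \<tau>(1) that]] \<tau>(2)[OF that]
      dist_triangle[of "f (\<sigma> (\<tau> t))" "k t" "g (\<tau> t)"] by linarith
  then show ?thesis
    using assms comp_time_change[OF \<sigma>(1) \<tau>(1)] unfolding skorokhod_close_def
    by (intro conjI bexI[of _ "\<lambda>t. \<sigma> (\<tau> t)"]) auto
qed

lemma skorokhod_close_ex:
  assumes "f \<in> skorokhod_space T" "g \<in> skorokhod_space T"
  shows "\<exists>\<epsilon>. skorokhod_close T f g \<epsilon>"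
proof -
  have "bounded (f ` {0..T} \<union> g ` {0..T})"
    using assms by (simp add: cadlag_bounded skorokhod_space_def)
  then obtain e where e: "\<forall>y\<in>f ` {0..T} \<union> g ` {0..T}. \<forall>z\<in>f ` {0..T} \<union> g ` {0..T}. dist y z \<le> e"
    by (meson bounded_two_points)
  have "skorokhod_close T f g (max e 1)"
    unfolding skorokhod_close_def
    using e by (intro conjI bexI[OF _ id_time_change]) (auto simp: le_max_iff_disj)
  then show ?thesis ..
qed

lemma skorokhod_close_bdd_below: "bdd_below {\<epsilon>. skorokhod_close T f g \<epsilon>}"
  by (rule bdd_belowI[of _ 0]) (auto simp: skorokhod_close_def)

lemma skorokhod_dist_nonneg: "0 \<le> skorokhod_dist T f g"
proof (cases "f \<in> skorokhod_space T \<and> g \<in> skorokhod_space T")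
  case True
  then have "0 \<le> Inf {\<epsilon>. skorokhod_close T f g \<epsilon>}"
    using skorokhod_close_ex[of f T g] by (intro cInf_greatest) (auto simp: skorokhod_close_def)
  then show ?thesis using True by (simp add: skorokhod_dist_eq)
qed (auto simp: skorokhod_dist_def)

lemma skorokhod_dist_commute: "skorokhod_dist T f g = skorokhod_dist T g f"
proof (cases "f \<in> skorokhod_space T \<and> g \<in> skorokhod_space T")
  case True
  moreover have "skorokhod_close T f g = skorokhod_close T g f"
    using skorokhod_close_sym by blast
  ultimately show ?thesis by (simp add: skorokhod_dist_eq)
qed (auto simp: skorokhod_dist_def)

lemma skorokhod_dist_le:
  assumes "f \<in> skorokhod_space T" "g \<in> skorokhod_space T" "skorokhod_close T f g \<epsilon>"
  shows "skorokhod_dist T f g \<le> \<epsilon>"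
  using assms by (auto simp: skorokhod_dist_eq intro!: cInf_lower skorokhod_close_bdd_below)

lemma skorokhod_dist_less:
  assumes "f \<in> skorokhod_space T" "g \<in> skorokhod_space T" "skorokhod_dist T f g < r"
  obtains \<epsilon> where "\<epsilon> < r" "skorokhod_close T f g \<epsilon>"
  using assms skorokhod_close_ex[OF assms(1,2)] cInf_lessD[of "{\<epsilon>. skorokhod_close T f g \<epsilon>}" r]
  by (auto simp: skorokhod_dist_eq)

lemma skorokhod_dist_0_eq:
  assumes "f \<in> skorokhod_space T" "g \<in> skorokhod_space T" "skorokhod_dist T f g = 0" "t \<in> {0..T}"
  shows "f t = g t"
proof -
  have close: "\<exists>\<tau>\<in>time_changes T. \<forall>t\<in>{0..T}. \<bar>\<tau> t - t\<bar> < e \<and> dist (f (\<tau> t)) (g t) < e"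
    if "e > 0" for e
  proof -
    have "skorokhod_dist T f g < e" using assms(3) that by simp
    then obtain \<epsilon> where "\<epsilon> < e" "skorokhod_close T f g \<epsilon>"
      using skorokhod_dist_less[OF assms(1,2)] by blast
    then show ?thesis unfolding skorokhod_close_def by (meson le_less_trans)
  qed
  have "dist (f t) (g t) < e" if "e > 0" for e
  proof (cases "t = T")
    case True
    obtain \<tau> where \<tau>: "\<tau> \<in> time_changes T"
      "\<forall>t\<in>{0..T}. \<bar>\<tau> t - t\<bar> < e \<and> dist (f (\<tau> t)) (g t) < e"
      using close \<open>e > 0\<close> by blast
    have "T \<in> \<tau> ` {0..T}"
      using \<tau>(1) assms(4) True by (auto simp: time_changes_def)
    then obtain s where s: "s \<in> {0..T}" "\<tau> s = T" by auto
    have "s = T"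
    proof (rule ccontr)
      assume "s \<noteq> T"
      then have "\<tau> s < \<tau> T"
        using \<tau>(1) s by (auto simp: time_changes_def strict_mono_on_def)
      then show False using s time_change_mem[OF \<tau>(1), of T] assms(4) True by auto
    qed
    show ?thesis using bspec[OF \<tau>(2) s(1)] s \<open>s = T\<close> True by simp
  next
    case False
    then have t: "0 \<le> t" "t < T" using assms(4) by auto
    have "(f \<longlongrightarrow> f t) (at_right t)" "(g \<longlongrightarrow> g t) (at_right t)"
      using assms(1,2) t unfolding skorokhod_space_def cadlag_def by auto
    moreover have "e / 3 > 0" using \<open>e > 0\<close> by simp
    ultimately have "eventually (\<lambda>s. dist (f s) (f t) < e / 3) (at_right t)"
      "eventually (\<lambda>s. dist (g s) (g t) < e / 3) (at_right t)"
      by (auto dest: tendstoD simp del: less_divide_eq_numeral1)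
    then have "eventually (\<lambda>s. dist (f s) (f t) < e / 3 \<and> dist (g s) (g t) < e / 3) (at_right t)"
      by (rule eventually_conj)
    then obtain b where b: "b > t"
      "\<And>s. t < s \<Longrightarrow> s < b \<Longrightarrow> dist (f s) (f t) < e / 3 \<and> dist (g s) (g t) < e / 3"
      by (auto simp: eventually_at_right_field)
    define c where "c = min b T"
    define s where "s = (t + c) / 2"
    have s: "t < s" "s < c" "s \<in> {0..T}" using b(1) t by (auto simp: s_def c_def)
    define d where "d = min (e / 3) (min (s - t) (c - s))"
    have "d > 0" using s that by (auto simp: d_def)
    then obtain \<tau> where \<tau>: "\<bar>\<tau> s - s\<bar> < d" "dist (f (\<tau> s)) (g s) < d"
      using close s(3) by blast
    have "t < \<tau> s" "\<tau> s < b" using \<tau>(1) by (auto simp: d_def c_def)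
    then have "dist (f (\<tau> s)) (f t) < e / 3" using b(2) by auto
    moreover have "dist (g s) (g t) < e / 3" using b(2) s by (auto simp: c_def)
    moreover have "dist (f (\<tau> s)) (g s) < e / 3" using \<tau>(2) by (auto simp: d_def)
    ultimately show ?thesis
      using dist_triangle[of "f t" "g t" "f (\<tau> s)"] dist_triangle[of "f (\<tau> s)" "g t" "g s"]
      by (simp add: dist_commute)
  qed
  then show ?thesis
    by (metis dist_pos_lt less_irrefl)
qed

lemma Metric_space_skorokhod:
  "Metric_space (skorokhod_space T :: (real \<Rightarrow> 'a::metric_space) set) (skorokhod_dist T)"
proof
  fix f g :: "real \<Rightarrow> 'a"
  show "skorokhod_dist T f g = skorokhod_dist T g f"
    by (rule skorokhod_dist_commute)
next
  fix f g :: "real \<Rightarrow> 'a"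
  show "0 \<le> skorokhod_dist T f g"
    by (rule skorokhod_dist_nonneg)
next
  fix f g :: "real \<Rightarrow> 'a"
  assume fg: "f \<in> skorokhod_space T" "g \<in> skorokhod_space T"
  show "skorokhod_dist T f g = 0 \<longleftrightarrow> f = g"
  proof
    assume "skorokhod_dist T f g = 0"
    then show "f = g"
      using skorokhod_dist_0_eq[OF fg] fg
      by (auto simp: skorokhod_space_def intro!: extensionalityI[of f "{0..T}" g])
  next
    assume "f = g"
    then have *: "skorokhod_close T f g e" if "e > 0" for e
      using that unfolding skorokhod_close_def
      by (intro conjI bexI[OF _ id_time_change]) auto
    have "skorokhod_dist T f g \<le> 0"
      by (rule field_le_epsilon) (use skorokhod_dist_le[OF fg] * in auto)
    then show "skorokhod_dist T f g = 0"
      using skorokhod_dist_nonneg[of T f g] by simp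
  qed
next
  fix f g k :: "real \<Rightarrow> 'a"
  assume fg: "f \<in> skorokhod_space T" "g \<in> skorokhod_space T" "k \<in> skorokhod_space T"
  show "skorokhod_dist T f k \<le> skorokhod_dist T f g + skorokhod_dist T g k"
  proof (rule field_le_epsilon)
    fix e :: real assume "e > 0"
    then have "skorokhod_dist T f g < skorokhod_dist T f g + e / 2"
      "skorokhod_dist T g k < skorokhod_dist T g k + e / 2" by auto
    then obtain a b where a: "a < skorokhod_dist T f g + e / 2" "skorokhod_close T f g a"
      and b: "b < skorokhod_dist T g k + e / 2" "skorokhod_close T g k b"
      using skorokhod_dist_less fg by metis
    show "skorokhod_dist T f k \<le> skorokhod_dist T f g + skorokhod_dist T g k + e"
      using skorokhod_dist_le[OF fg(1,3) skorokhod_close_trans[OF a(2) b(2)]] a(1) b(1) by linarith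
  qed
qed

lemma topspace_skorokhod [simp]:
  "topspace (skorokhod_topology T :: (real \<Rightarrow> 'a::metric_space) topology) = skorokhod_space T"
  unfolding skorokhod_topology_def
  by (rule Metric_space.topspace_mtopology[OF Metric_space_skorokhod])


section \<open>Convergence in distribution\<close>

text \<open>Random elements enter through their laws, which are discrete in the application: a step of
  the agent-based model has finitely many outcomes, and the limit is deterministic.\<close>

definition converges_in_distribution ::
  "'a topology \<Rightarrow> ('b \<Rightarrow> 'a pmf) \<Rightarrow> 'a pmf \<Rightarrow> 'b filter \<Rightarrow> bool" where
  "converges_in_distribution S \<nu> \<nu>\<^sub>0 F \<longleftrightarrow>
     (\<forall>f :: 'a \<Rightarrow> real. continuous_map S euclideanreal f \<and> bounded (f ` topspace S) \<longrightarrow>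
        ((\<lambda>h. measure_pmf.expectation (\<nu> h) f) \<longlongrightarrow> measure_pmf.expectation \<nu>\<^sub>0 f) F)"


section \<open>The agent-based model with selection by node degree\<close>

definition node_degree :: "real^'n^'n \<Rightarrow> 'n \<Rightarrow> real" where
  "node_degree A i = (\<Sum>l\<in>UNIV. A $ i $ l)"

definition select_pmf :: "real^'n^'n \<Rightarrow> 'n \<Rightarrow> 'n pmf" where
  "select_pmf A i = embed_pmf (\<lambda>j. A $ i $ j / node_degree A i)"

lemma pmf_select_pmf:
  fixes A :: "real^'n^'n"
  assumes "\<And>i j. 0 \<le> A $ i $ j" "\<And>i. A $ i $ i = 1"
  shows "pmf (select_pmf A i) j = A $ i $ j / node_degree A i"
proof -
  have "A $ i $ i \<le> node_degree A i"
    unfolding node_degree_def by (rule member_le_sum) (use assms in auto)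
  then have "node_degree A i > 0" using assms(2)[of i] by simp
  moreover have "(\<Sum>j\<in>UNIV. A $ i $ j / node_degree A i) = node_degree A i / node_degree A i"
    unfolding node_degree_def by (rule sum_divide_distrib[symmetric])
  ultimately show ?thesis
    unfolding select_pmf_def using assms(1)
    by (subst pmf_embed_pmf)
       (auto simp: nn_integral_count_space_finite sum_ennreal intro!: divide_nonneg_pos)
qed

text \<open>One timestep: choose \<open>i\<close> uniformly, then \<open>j\<close>, then decide whether the update with
  update distance \<open>\<mu>\<close> takes place.\<close>

definition abm_step ::
  "real^'n^'n \<Rightarrow> ('n \<Rightarrow> 'n \<Rightarrow> real^'n \<Rightarrow> real) \<Rightarrow> real \<Rightarrow> real^'n \<Rightarrow> (real^'n) pmf" where
  "abm_step A p \<mu> x =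
     do {
       i \<leftarrow> pmf_of_set UNIV;
       j \<leftarrow> select_pmf A i;
       b \<leftarrow> bernoulli_pmf (p i j x);
       return_pmf (if b then \<chi> l. if l = i then x $ i + \<mu> * (x $ j - x $ i) else x $ l else x)
     }"

text \<open>Joint law of the first \<open>n + 1\<close> states of the Markov chain, as a function of the step
  number; the values at step numbers beyond \<open>n\<close> are irrelevant (they are \<open>x0\<close>).\<close>

primrec abm_chain ::
  "real^'n^'n \<Rightarrow> ('n \<Rightarrow> 'n \<Rightarrow> real^'n \<Rightarrow> real) \<Rightarrow> real \<Rightarrow> real^'n \<Rightarrow> nat \<Rightarrow> (nat \<Rightarrow> real^'n) pmf"
  where
  "abm_chain A p \<mu> x0 0 = return_pmf (\<lambda>_. x0)"
| "abm_chain A p \<mu> x0 (Suc n) =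
     do {
       \<omega> \<leftarrow> abm_chain A p \<mu> x0 n;
       y \<leftarrow> abm_step A p \<mu> (\<omega> n);
       return_pmf (fun_upd \<omega> (Suc n) y)
     }"

definition trajectory :: "real \<Rightarrow> real \<Rightarrow> (nat \<Rightarrow> 'a) \<Rightarrow> real \<Rightarrow> 'a" where
  "trajectory h T \<omega> = (\<lambda>t\<in>{0..T}. \<omega> (nat \<lfloor>t / h\<rfloor>))"

lemma trajectory_in_skorokhod_space:
  assumes "h > 0"
  shows "trajectory h T \<omega> \<in> skorokhod_space T"
proof -
  have right: "(trajectory h T \<omega> \<longlongrightarrow> trajectory h T \<omega> t) (at_right t)" if t: "0 \<le> t" "t < T" for t
  proof -
    define b where "b = min T (h * (of_int \<lfloor>t / h\<rfloor> + 1))"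
    have "t / h < of_int \<lfloor>t / h\<rfloor> + 1" by linarith
    then have "t < b" using t assms by (simp add: b_def field_simps)
    moreover have "trajectory h T \<omega> s = trajectory h T \<omega> t" if s: "t < s" "s < b" for s
    proof -
      have "t / h < s / h" using s assms by (simp add: divide_strict_right_mono)
      moreover have "s / h < of_int \<lfloor>t / h\<rfloor> + 1" using s assms by (simp add: b_def field_simps)
      ultimately have "\<lfloor>s / h\<rfloor> = \<lfloor>t / h\<rfloor>" by linarith
      then show ?thesis using s t by (simp add: trajectory_def b_def)
    qed
    ultimately show ?thesis
      by (intro tendsto_eventually) (auto simp: eventually_at_right_field)
  qed
  have left: "\<exists>l. (trajectory h T \<omega> \<longlongrightarrow> l) (at_left t)" if t: "0 < t" "t \<le> T" for t
  proof -
    define k where "k = \<lceil>t / h\<rceil> - 1"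
    define b where "b = max 0 (h * of_int k)"
    have k: "of_int k < t / h" "t / h \<le> of_int k + 1" unfolding k_def by linarith+
    then have "b < t" using t assms by (simp add: b_def field_simps)
    moreover have "trajectory h T \<omega> s = \<omega> (nat k)" if s: "b < s" "s < t" for s
    proof -
      have "s / h < t / h" using s assms by (simp add: divide_strict_right_mono)
      moreover have "of_int k < s / h" using s assms by (simp add: b_def field_simps)
      ultimately have "\<lfloor>s / h\<rfloor> = k" using k by linarith
      then show ?thesis using s t by (simp add: trajectory_def b_def)
    qed
    ultimately show ?thesis
      by (intro exI[of _ "\<omega> (nat k)"] tendsto_eventually) (auto simp: eventually_at_left_field)
  qed
  show ?thesis
    using left right by (auto simp: skorokhod_space_def cadlag_def trajectory_def)
qed

text \<open>Law of the trajectory on $[0,T]$, which involves the first $\lfloor T/h \rfloor$ steps.\<close>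

definition abm_law ::
  "real^'n^'n \<Rightarrow> ('n \<Rightarrow> 'n \<Rightarrow> real^'n \<Rightarrow> real) \<Rightarrow> real \<Rightarrow> real^'n \<Rightarrow> real \<Rightarrow> real
     \<Rightarrow> (real \<Rightarrow> real^'n) pmf" where
  "abm_law A p \<mu> x0 T h = map_pmf (trajectory h T) (abm_chain A p \<mu> x0 (nat \<lfloor>T / h\<rfloor>))"


section \<open>The limiting differential equation\<close>

definition ode_solution ::
  "real^'n^'n \<Rightarrow> ('n \<Rightarrow> 'n \<Rightarrow> real^'n \<Rightarrow> real) \<Rightarrow> real^'n \<Rightarrow> real \<Rightarrow> (real \<Rightarrow> real^'n) \<Rightarrow> bool" where
  "ode_solution A p x0 T X \<longleftrightarrow>
     X \<in> extensional {0..T} \<and> X 0 = x0 \<and>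
     (\<forall>t\<in>{0..T}. \<forall>i.
        ((\<lambda>s. X s $ i) has_real_derivative
           1 / node_degree A i * (\<Sum>j\<in>UNIV. A $ i $ j * p i j (X t) * (X t $ j - X t $ i)))
        (at t within {0..T}))"

end

theory Submission
  imports Defs
begin

text \<open>The chain and every solution of the differential equation stay in a box, on which the drift
  \<open>F\<close> is Lipschitz. With \<open>\<mu> = N h\<close> the mean of a step from \<open>x\<close> is \<open>h F x\<close>, and every step has
  size \<open>O(h)\<close>; hence the error \<open>e\<^sub>n = |x(n h) - X(n h)|\<close> satisfies
  \<open>E e\<^sub>n\<^sub>+\<^sub>1\<^sup>2 \<le> (1 + 2 L h) E e\<^sub>n\<^sup>2 + C h\<^sup>2\<close>, so that \<open>E e\<^sub>n\<^sup>2 = O(h)\<close> uniformly in \<open>n h \<le> T\<close>.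
  No martingale inequality is needed for the maximum over \<open>n\<close>: since \<open>e\<^sub>0 = 0\<close> and the increments
  of \<open>e\<close> are \<open>O(h)\<close>, \<open>max e\<^sub>n\<^sup>3\<close> is at most \<open>O(h) \<Sum> e\<^sub>k\<^sup>2\<close>, whose expectation is \<open>O(h)\<close>. Uniform
  closeness bounds the Skorokhod distance by taking the identity as time change.\<close>

section \<open>Ordinary differential equations\<close>

lemma picard_lipschitz:
  fixes G :: "'a::euclidean_space \<Rightarrow> 'a"
  assumes T: "0 \<le> T" and L: "0 \<le> L" and lip: "\<And>x y. norm (G x - G y) \<le> L * norm (x - y)"
  shows "\<exists>X. X 0 = x0 \<and> (\<forall>t\<in>{0..T}. (X has_vector_derivative G (X t)) (at t within {0..T}))"
proof -
  \<comment> \<open>Working with \<open>y t = exp (- K t) X t\<close> instead of \<open>X\<close> makes the Picard map a contraction on all of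
    \<open>{0..T}\<close> at once. Times are clamped to \<open>{0..T}\<close> to obtain bounded functions on \<open>real\<close>.\<close>
  define K where "K = 2 * L + 1"
  \<comment> \<open>The weighted Picard map contracts with ratio \<open>L / K\<close>; the summand
    \<open>1\<close> in \<open>K\<close> keeps \<open>K\<close> positive when
    \<open>L = 0\<close>.\<close>
  have K: "K > 0" "L / K \<le> 1 / 2" using L by (auto simp: K_def field_simps)
  have contG: "continuous_on S G" for S
  proof (rule lipschitz_on_continuous_on)
    show "L-lipschitz_on S G"
      using lip L by (auto simp: lipschitz_on_def dist_norm)
  qed
  define f where "f y s = G (exp (K * s) *\<^sub>R apply_bcontfun y s)" for y s
  have contf: "continuous_on S (f y)" for y S
    unfolding f_def
    by (intro continuous_on_compose2[OF contG[of UNIV]] continuous_intros) auto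
  \<comment> \<open>The usual Picard map for \<open>X\<close>, conjugated with the weight;
    \<open>f y s\<close> is \<open>G (X s)\<close> expressed through \<open>y\<close>.\<close>
  define H where "H y t = exp (- K * t) *\<^sub>R (x0 + integral {0..t} (f y))" for y t
  have contI: "continuous_on {0..T} (\<lambda>t. integral {0..t} (f y))" for y
    by (rule indefinite_integral_continuous_1) (intro integrable_continuous_real contf)
  have contH: "continuous_on (cbox 0 T) (H y)" for y
    unfolding H_def by (intro continuous_intros) (use contI in auto)
  have mem: "(\<lambda>t. H y (clamp 0 T t)) \<in> bcontfun" for y
    unfolding bcontfun_def using clamp_continuous_on[OF contH] T
      clamp_bounded[OF compact_imp_bounded[OF compact_continuous_image[OF contH compact_cbox]]] by auto
  define \<Phi> where "\<Phi> y = Bcontfun (\<lambda>t. H y (clamp 0 T t))" for y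
  have \<Phi>: "apply_bcontfun (\<Phi> y) t = H y (clamp 0 T t)" for y t
    unfolding \<Phi>_def by (simp add: Bcontfun_inverse mem)
  have contraction: "dist (\<Phi> y) (\<Phi> z) \<le> (1/2) * dist y z" for y z
  proof (rule dist_bound)
    fix t
    define u where "u = clamp 0 T t"
    have "u \<in> cbox 0 T" using T unfolding u_def by (intro clamp_in_interval) auto
    then have u: "0 \<le> u" by simp
    have i: "((\<lambda>s. exp (K * s)) has_integral (exp (K * u) / K - exp (K * 0) / K)) {0..u}"
      using u K
      by (intro fundamental_theorem_of_calculus)
         (auto intro!: derivative_eq_intros simp: has_real_derivative_iff_has_vector_derivative[symmetric])
    have "H y u - H z u = exp (- K * u) *\<^sub>R (integral {0..u} (f y) - integral {0..u} (f z))"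
      by (simp add: H_def algebra_simps)
    also have "integral {0..u} (f y) - integral {0..u} (f z) = integral {0..u} (\<lambda>s. f y s - f z s)"
      by (intro integral_diff[symmetric] integrable_continuous_real contf)
    finally have "norm (H y u - H z u) = exp (- K * u) * norm (integral {0..u} (\<lambda>s. f y s - f z s))"
      by simp
    also have "norm (integral {0..u} (\<lambda>s. f y s - f z s)) \<le>
        integral {0..u} (\<lambda>s. (L * dist y z) * exp (K * s))"
    proof (rule integral_norm_bound_integral)
      show "(\<lambda>s. f y s - f z s) integrable_on {0..u}"
        by (intro integrable_continuous_real continuous_intros contf)
      show "(\<lambda>s. (L * dist y z) * exp (K * s)) integrable_on {0..u}"
        by (intro integrable_continuous_real continuous_intros)
      fix s
      have "norm (f y s - f z s) \<le> L * norm (exp (K * s) *\<^sub>R (apply_bcontfun y s - apply_bcontfun z s))"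
        unfolding f_def scaleR_diff_right by (rule lip)
      also have "\<dots> = L * (exp (K * s) * dist (apply_bcontfun y s) (apply_bcontfun z s))"
        by (simp add: dist_norm)
      also have "\<dots> \<le> L * (exp (K * s) * dist y z)"
        using L by (intro mult_left_mono dist_bounded) auto
      finally show "norm (f y s - f z s) \<le> (L * dist y z) * exp (K * s)" by (simp add: mult_ac)
    qed
    also have "integral {0..u} (\<lambda>s. (L * dist y z) * exp (K * s)) =
        (L * dist y z) * (exp (K * u) / K - exp (K * 0) / K)"
      using i by (simp add: integral_unique)
    also have "\<dots> \<le> (L * dist y z) * (exp (K * u) / K)"
      using L K by (intro mult_left_mono) auto
    finally have "norm (H y u - H z u) \<le> exp (- K * u) * ((L * dist y z) * (exp (K * u) / K))"
      by simp
    also have "\<dots> = L / K * dist y z" by (simp add: exp_minus field_simps)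
    also have "\<dots> \<le> (1/2) * dist y z" using K(2) by (intro mult_right_mono) auto
    finally show "dist (apply_bcontfun (\<Phi> y) t) (apply_bcontfun (\<Phi> z) t) \<le> (1/2) * dist y z"
      by (simp add: \<Phi> u_def dist_norm)
  qed
  obtain y where y: "\<Phi> y = y"
    using banach_fix_type[of "1/2" \<Phi>] contraction by auto
  define X where "X t = exp (K * t) *\<^sub>R apply_bcontfun y t" for t
  have X: "X t = x0 + integral {0..t} (\<lambda>s. G (X s))" if "t \<in> {0..T}" for t
  proof -
    have "apply_bcontfun y t = H y (clamp 0 T t)" using \<Phi>[of y t] y by simp
    also have "clamp 0 T t = t" using that by (intro clamp_cancel_cbox) auto
    finally have "X t = exp (K * t) *\<^sub>R exp (- K * t) *\<^sub>R (x0 + integral {0..t} (f y))"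
      by (simp add: X_def H_def)
    also have "\<dots> = x0 + integral {0..t} (f y)" by (simp add: exp_minus)
    finally show ?thesis by (simp add: f_def[abs_def] X_def[abs_def])
  qed
  have "(X has_vector_derivative G (X t)) (at t within {0..T})" if t: "t \<in> {0..T}" for t
  proof -
    have "continuous_on {0..T} (\<lambda>s. G (X s))"
      using contf[of _ y] by (simp add: f_def[abs_def] X_def[abs_def])
    then have "((\<lambda>u. x0 + integral {0..u} (\<lambda>s. G (X s))) has_vector_derivative 0 + G (X t))
        (at t within {0..T})"
      by (intro has_vector_derivative_add integral_has_vector_derivative t has_vector_derivative_const)
    then show ?thesis
      using has_vector_derivative_transform[OF t X] by simp
  qed
  moreover have "X 0 = x0" using X[of 0] T by simp
  ultimately show ?thesis by blast
qed

text \<open>Links the componentwise form of \<open>ode_solution\<close> with the vector derivative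
  on which the norm estimates rest.\<close>

lemma has_vector_derivative_vec_iff:
  fixes X :: "real \<Rightarrow> real^'n"
  shows "(X has_vector_derivative v) (at t within S) \<longleftrightarrow>
    (\<forall>i. ((\<lambda>s. X s $ i) has_real_derivative v $ i) (at t within S))"
  unfolding has_vector_derivative_def
  by (subst has_derivative_componentwise_within)
     (auto simp: Basis_vec_def inner_axis has_field_derivative_def mult_commute_abs)

text \<open>Gronwall's argument: by Cauchy-Schwarz and the Lipschitz bound, the squared distance
  grows at rate at most \<open>2 * L\<close>, so damping it by \<open>exp (- (2 * L * s))\<close>
  makes it nonincreasing. The set \<open>B\<close> allows for a field that is Lipschitz only where
  both solutions live.\<close>

lemma ode_uniqueness:
  fixes X Y :: "real \<Rightarrow> 'a::real_inner"
  assumes X: "\<And>t. t \<in> {0..T} \<Longrightarrow> (X has_vector_derivative F (X t)) (at t within {0..T})"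
    and Y: "\<And>t. t \<in> {0..T} \<Longrightarrow> (Y has_vector_derivative F (Y t)) (at t within {0..T})"
    and B: "\<And>t. t \<in> {0..T} \<Longrightarrow> X t \<in> B \<and> Y t \<in> B"
    and lip: "\<And>x y. x \<in> B \<Longrightarrow> y \<in> B \<Longrightarrow> norm (F x - F y) \<le> L * norm (x - y)"
    and init: "X 0 = Y 0" and t: "t \<in> {0..T}"
  shows "X t = Y t"
proof -
  define u where "u s = exp (- (2 * L * s)) * ((X s - Y s) \<bullet> (X s - Y s))" for s
  define u' where "u' s = exp (- (2 * L * s)) *
     (2 * ((X s - Y s) \<bullet> (F (X s) - F (Y s))) - 2 * L * ((X s - Y s) \<bullet> (X s - Y s)))" for s
  have d: "(u has_real_derivative u' s) (at s within {0..T})" if s: "s \<in> {0..T}" for s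
  proof -
    note [derivative_intros] = has_derivative_scaleR_right
      X[OF s, unfolded has_vector_derivative_def] Y[OF s, unfolded has_vector_derivative_def]
    show ?thesis
      unfolding u_def u'_def has_field_derivative_def
      by (rule derivative_eq_intros refl | simp)+
         (auto simp: fun_eq_iff algebra_simps inner_commute)
  qed
  have "u t \<le> u 0"
  proof (rule DERIV_nonpos_imp_decreasing_open[of 0 t u])
    show "0 \<le> t" using t by simp
  next
    fix s :: real assume s: "0 < s" "s < t"
    then have sT: "s \<in> {0..T}" using t by auto
    have "(X s - Y s) \<bullet> (F (X s) - F (Y s)) \<le> norm (X s - Y s) * norm (F (X s) - F (Y s))"
      by (rule norm_cauchy_schwarz)
    also have "\<dots> \<le> norm (X s - Y s) * (L * norm (X s - Y s))"
      using lip B[OF sT] by (intro mult_left_mono) auto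
    also have "\<dots> = L * ((X s - Y s) \<bullet> (X s - Y s))"
      by (simp add: power2_norm_eq_inner[symmetric] power2_eq_square)
    finally have "u' s \<le> 0" unfolding u'_def by (intro mult_nonneg_nonpos) auto
    \<comment> \<open>The decrease criterion asks for two-sided derivatives; at interior points the
      derivative relative to \<open>{0..T}\<close> is one.\<close>
    moreover have "at s within {0..T} = at s" using s t by (intro at_within_interior) auto
    ultimately show "\<exists>y. (u has_real_derivative y) (at s) \<and> y \<le> 0" using d[OF sT] by auto
  next
    show "continuous_on {0..t} u"
      by (rule continuous_on_subset[OF DERIV_continuous_on[of "{0..T}" u u']]) (use d t in auto)
  qed
  then have "exp (- (2 * L * t)) * ((X t - Y t) \<bullet> (X t - Y t)) \<le> 0" by (simp add: u_def init)
  then have "(X t - Y t) \<bullet> (X t - Y t) \<le> 0" by (simp add: mult_le_0_iff)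
  then show ?thesis by (metis inner_ge_zero inner_eq_zero_iff eq_iff_diff_eq_0 order_antisym)
qed

text \<open>Barrier argument: let \<open>r\<close> be the last time up to \<open>t\<close> with
  \<open>g r \<le> M\<close>. After \<open>r\<close> the function lies above \<open>M\<close>, hence
  does not increase, so \<open>g t \<le> g r\<close>.\<close>

lemma derivative_nonpos_above_imp_bounded:
  fixes g :: "real \<Rightarrow> real"
  assumes d: "\<And>s. s \<in> {0..T} \<Longrightarrow> (g has_real_derivative g' s) (at s within {0..T})"
    and neg: "\<And>s. s \<in> {0..T} \<Longrightarrow> M < g s \<Longrightarrow> g' s \<le> 0"
    and init: "g 0 \<le> M" and t: "t \<in> {0..T}"
  shows "g t \<le> M"
proof (rule ccontr)
  assume "\<not> g t \<le> M"
  have cont: "continuous_on {0..T} g" using d by (intro DERIV_continuous_on)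
  define S where "S = {s \<in> {0..t}. g s \<le> M}"
  have "closed S"
    unfolding S_def using continuous_on_subset[OF cont, of "{0..t}"] t
    by (intro continuous_on_closed_Collect_le continuous_intros) auto
  moreover have "0 \<in> S" and bdd: "bdd_above S" using init t by (auto simp: S_def)
  ultimately have r: "Sup S \<in> S" by (intro closed_contains_Sup) auto
  define r where "r = Sup S"
  have r0: "0 \<le> r" "r \<le> t" "g r \<le> M" using r by (auto simp: S_def r_def)
  have above: "M < g s" if "r < s" "s \<le> t" for s
  proof (rule ccontr)
    assume "\<not> M < g s"
    then have "s \<in> S" using that r0 by (auto simp: S_def)
    then have "s \<le> r" unfolding r_def using bdd by (rule cSup_upper)
    then show False using that by simp
  qed
  have "g t \<le> g r"
  proof (rule DERIV_nonpos_imp_decreasing_open[of r t g])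
    show "r \<le> t" by (rule r0)
  next
    fix s :: real assume s: "r < s" "s < t"
    then have sT: "s \<in> {0..T}" using t r0 by auto
    have "at s within {0..T} = at s" using s t r0 by (intro at_within_interior) auto
    then show "\<exists>y. (g has_real_derivative y) (at s) \<and> y \<le> 0"
      using d[OF sT] neg[OF sT above] s by auto
  next
    show "continuous_on {r..t} g" using t r0 by (intro continuous_on_subset[OF cont]) auto
  qed
  then show False using r0 \<open>\<not> g t \<le> M\<close> by simp
qed

section \<open>Expectations and sequences\<close>

lemma expectation_bind_finite:
  fixes g :: "'b \<Rightarrow> real"
  assumes "finite (set_pmf q)" "\<And>x. x \<in> set_pmf q \<Longrightarrow> finite (set_pmf (f x))"
  shows "measure_pmf.expectation (q \<bind> f) g =
    measure_pmf.expectation q (\<lambda>x. measure_pmf.expectation (f x) g)"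
  using assms
  by (subst pmf_expectation_bind[of "set_pmf q"])
     (auto simp: integral_measure_pmf[of "set_pmf q"])

lemma expectation_mono_finite:
  fixes f g :: "'a \<Rightarrow> real"
  assumes "finite (set_pmf q)" "\<And>x. x \<in> set_pmf q \<Longrightarrow> f x \<le> g x"
  shows "measure_pmf.expectation q f \<le> measure_pmf.expectation q g"
  using assms
  by (intro integral_mono_AE integrable_measure_pmf_finite) (auto simp: AE_measure_pmf_iff)

text \<open>Telescope \<open>b\<^sup>3 - a\<^sup>3 = (b - a) (a\<^sup>2 + a b + b\<^sup>2) \<le> 3/2 c (a\<^sup>2 + b\<^sup>2)\<close>.\<close>

lemma cube_le_sum_squares:
  fixes d :: "nat \<Rightarrow> real"
  assumes "d 0 = 0" "\<And>k. 0 \<le> d k" "0 \<le> c" "\<And>k. k < n \<Longrightarrow> d (Suc k) \<le> d k + c" "m \<le> n"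
  shows "d m ^ 3 \<le> 3 * c * (\<Sum>k\<le>n. (d k)\<^sup>2)"
proof -
  \<comment> \<open>Each square borders two telescoped increments, but the last one borders only one
    so far; hence the weights 2 and 1.\<close>
  have "d m ^ 3 \<le> 3 / 2 * c * (2 * (\<Sum>k<m. (d k)\<^sup>2) + (d m)\<^sup>2)"
    using \<open>m \<le> n\<close>
  proof (induction m)
    case 0
    then show ?case using assms by simp
  next
    case (Suc m)
    define a b where "a = d m" and "b = d (Suc m)"
    have ab: "0 \<le> a" "0 \<le> b" "b - a \<le> c"
      using assms(2) assms(4)[of m] Suc.prems by (auto simp: a_def b_def)
    have "2 * (a * b) \<le> a\<^sup>2 + b\<^sup>2" using sum_squares_bound[of a b] by simp
    then have q: "a\<^sup>2 + a * b + b\<^sup>2 \<le> 3 / 2 * (a\<^sup>2 + b\<^sup>2)" by simp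
    have "b ^ 3 - a ^ 3 = (b - a) * (a\<^sup>2 + a * b + b\<^sup>2)"
      by (simp add: power3_eq_cube power2_eq_square algebra_simps)
    also have "\<dots> \<le> c * (a\<^sup>2 + a * b + b\<^sup>2)" using ab by (intro mult_right_mono) auto
    also have "\<dots> \<le> c * (3 / 2 * (a\<^sup>2 + b\<^sup>2))" using q assms(3) by (rule mult_left_mono)
    finally show ?case using Suc by (simp add: a_def b_def algebra_simps)
  qed
  also have "\<dots> \<le> 3 / 2 * c * (2 * (\<Sum>k\<le>m. (d k)\<^sup>2))"
    using assms(3) by (intro mult_left_mono) (auto simp: lessThan_Suc_atMost[symmetric])
  also have "\<dots> \<le> 3 / 2 * c * (2 * (\<Sum>k\<le>n. (d k)\<^sup>2))"
    using assms(3,5) by (intro mult_left_mono sum_mono2) auto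
  finally show ?thesis by simp
qed

section \<open>The Skorokhod space\<close>

text \<open>The limit law is a point mass, so a test function enters through its epsilon-delta
  continuity at the single path \<open>X\<close>.\<close>

lemma continuous_map_skorokhodD:
  fixes f :: "(real \<Rightarrow> 'a::metric_space) \<Rightarrow> real"
  assumes f: "continuous_map (skorokhod_topology T) euclideanreal f"
    and X: "X \<in> skorokhod_space T" and e: "0 < e"
  obtains r where "0 < r"
    "\<And>g. g \<in> skorokhod_space T \<Longrightarrow> skorokhod_dist T X g < r \<Longrightarrow> \<bar>f g - f X\<bar> < e"
proof -
  interpret Metric_space "skorokhod_space T :: (real \<Rightarrow> 'a) set" "skorokhod_dist T"
    by (rule Metric_space_skorokhod)
  have "openin (skorokhod_topology T) {g \<in> topspace (skorokhod_topology T). f g \<in> ball (f X) e}"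
    using f by (rule openin_continuous_map_preimage) simp
  then have "openin mtopology {g \<in> skorokhod_space T. f g \<in> ball (f X) e}"
    by (simp add: skorokhod_topology_def)
  then obtain r where "r > 0" "mball X r \<subseteq> {g \<in> skorokhod_space T. f g \<in> ball (f X) e}"
    using X e unfolding openin_mtopology by fastforce
  then show thesis
    using X by (intro that[of r]) (auto simp: in_mball dist_real_def abs_minus_commute subset_iff)
qed

lemma continuous_in_skorokhod_space:
  assumes "continuous_on {0..T} f" "f \<in> extensional {0..T}"
  shows "f \<in> skorokhod_space T"
proof -
  have lim: "(f \<longlongrightarrow> f t) (at t within S)" if "t \<in> {0..T}" "S \<subseteq> {0..T}" for t S
    using assms(1) that by (auto simp: continuous_on_def intro: tendsto_within_subset)
  have "(f \<longlongrightarrow> f t) (at_right t)" if "t \<in> {0..<T}" for t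
    using lim[of t "{t..T}"] that by (simp add: at_within_Icc_at_right)
  moreover have "(f \<longlongrightarrow> f t) (at_left t)" if "t \<in> {0<..T}" for t
    using lim[of t "{0..t}"] that by (simp add: at_within_Icc_at_left)
  ultimately show ?thesis
    using assms(2) unfolding skorokhod_space_def cadlag_def by blast
qed

lemma skorokhod_dist_le_uniform:
  assumes "f \<in> skorokhod_space T" "g \<in> skorokhod_space T" "0 < e"
    "\<And>t. t \<in> {0..T} \<Longrightarrow> dist (f t) (g t) \<le> e"
  shows "skorokhod_dist T f g \<le> e"
  using assms id_time_change[of T]
  by (intro skorokhod_dist_le) (auto simp: skorokhod_close_def intro!: bexI[of _ "\<lambda>t. t"])

section \<open>The drift and single steps of the chain\<close>

text \<open>A ball of the maximum norm rather than the Euclidean one: convex combinations of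
  coordinates stay below the same bound, and the faces can be treated one coordinate at a
  time.\<close>

definition box_of :: "real \<Rightarrow> (real^'n) set" where
  "box_of M = {x. \<forall>i. \<bar>x $ i\<bar> \<le> M}"

lemma bounded_subset_box_of:
  fixes S :: "(real^'n) set"
  assumes "bounded S"
  obtains M where "0 \<le> M" "S \<subseteq> box_of M"
proof -
  obtain B where B: "0 < B" "\<And>x. x \<in> S \<Longrightarrow> norm x \<le> B"
    using assms by (auto simp: bounded_pos)
  then have "S \<subseteq> box_of B"
    unfolding box_of_def using order_trans[OF component_le_norm_cart B(2)] by blast
  then show thesis using B by (intro that[of B]) auto
qed

lemma norm_le_box_of: "x \<in> box_of M \<Longrightarrow> norm (x :: real^'n) \<le> real CARD('n) * M"
  using norm_le_l1_cart[of x] sum_mono[of UNIV "\<lambda>i. \<bar>x $ i\<bar>" "\<lambda>_. M"] by (simp add: box_of_def)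

text \<open>Names the outcome of a successful update in \<open>abm_step\<close>.\<close>

definition move :: "'n \<Rightarrow> 'n \<Rightarrow> real \<Rightarrow> real^'n \<Rightarrow> real^'n" where
  "move i j \<mu> x = (\<chi> l. if l = i then x $ i + \<mu> * (x $ j - x $ i) else x $ l)"

lemma box_of_diff_le:
  assumes "x \<in> box_of M"
  shows "\<bar>x $ j - x $ i\<bar> \<le> 2 * M"
proof -
  have "\<bar>x $ j\<bar> \<le> M" "\<bar>x $ i\<bar> \<le> M" using assms by (auto simp: box_of_def)
  then show ?thesis by linarith
qed

lemma move_diff: "move i j \<mu> x - x = (\<mu> * (x $ j - x $ i)) *\<^sub>R axis i 1"
  by (simp add: move_def vec_eq_iff axis_def)

lemma norm_move_diff:
  assumes "x \<in> box_of M" "0 \<le> \<mu>"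
  shows "norm (move i j \<mu> x - x) \<le> 2 * M * \<mu>"
proof -
  have "\<bar>x $ j - x $ i\<bar> \<le> 2 * M"
    using assms(1) by (rule box_of_diff_le)
  then show ?thesis
    using assms by (simp add: move_diff abs_mult mult.commute mult_left_mono)
qed

text \<open>For \<open>\<mu>\<close> between 0 and 1 the new coordinate is a convex combination of
  two old ones.\<close>

lemma move_in_box_of:
  assumes "x \<in> box_of M" "0 \<le> \<mu>" "\<mu> \<le> 1"
  shows "move i j \<mu> x \<in> box_of M"
proof -
  have "\<bar>x $ i + \<mu> * (x $ j - x $ i)\<bar> = \<bar>(1 - \<mu>) * x $ i + \<mu> * x $ j\<bar>"
    by (simp add: algebra_simps)
  also have "\<dots> \<le> (1 - \<mu>) * \<bar>x $ i\<bar> + \<mu> * \<bar>x $ j\<bar>"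
    using assms abs_triangle_ineq[of "(1 - \<mu>) * x $ i" "\<mu> * x $ j"] by (simp add: abs_mult)
  also have "\<dots> \<le> M"
    using assms by (intro convex_bound_le) (auto simp: box_of_def)
  finally show ?thesis using assms by (auto simp: move_def box_of_def)
qed

locale abm =
  fixes A :: "real^'n^'n" and p :: "'n \<Rightarrow> 'n \<Rightarrow> real^'n \<Rightarrow> real"
  assumes p_range: "p i j x \<in> {0..1}"
    and p_lipschitz: "\<exists>L. L-lipschitz_on UNIV (p i j)"
    and A_range: "A $ i $ j \<in> {0..1}"
    and A_diag: "A $ i $ i = 1"
begin

text \<open>The field called \<open>F\<close> in the overview.\<close>

definition drift :: "real^'n \<Rightarrow> real^'n" where
  "drift x = (\<chi> i. 1 / node_degree A i * (\<Sum>j\<in>UNIV. A $ i $ j * p i j x * (x $ j - x $ i)))"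

lemma drift_nth:
  "drift x $ i = 1 / node_degree A i * (\<Sum>j\<in>UNIV. A $ i $ j * p i j x * (x $ j - x $ i))"
  by (simp add: drift_def)

lemma node_degree_ge_1: "1 \<le> node_degree A i"
proof -
  have "A $ i $ i \<le> node_degree A i"
    unfolding node_degree_def by (rule member_le_sum) (use A_range in auto)
  then show ?thesis using A_diag by simp
qed

text \<open>All opinion differences vanish at a consensus. Comparison with this zero turns the
  Lipschitz bound into a bound on the drift itself.\<close>

lemma drift_0: "drift 0 = 0"
  by (simp add: drift_def vec_eq_iff)

text \<open>Each term is a product of a bounded Lipschitz function and an opinion difference. The
  restriction to a box bounds the second factor as well.\<close>

lemma drift_lipschitz_on_box:
  assumes "0 \<le> M"
  obtains L where "0 \<le> L"
    "\<And>x y. x \<in> box_of M \<Longrightarrow> y \<in> box_of M \<Longrightarrow> norm (drift x - drift y) \<le> L * norm (x - y)"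
proof -
  obtain Lp where Lp: "(Lp i j)-lipschitz_on UNIV (p i j)" for i j
    using p_lipschitz by metis
  \<comment> \<open>Per pair, varying \<open>p\<close> costs \<open>Lp i j * (2 * M)\<close> and
    varying the opinion difference costs 2; the weights \<open>A\<close> and the inverse degrees are
    at most 1. The sum over \<open>i\<close> comes from estimating the norm by the l1 norm.\<close>
  define L where "L = (\<Sum>i\<in>UNIV. \<Sum>j\<in>UNIV. Lp i j * (2 * M) + 2)"
  have "0 \<le> L"
    unfolding L_def using Lp[THEN lipschitz_on_nonneg] assms by (intro sum_nonneg add_nonneg_nonneg) auto
  moreover have "norm (drift x - drift y) \<le> L * norm (x - y)"
    if x: "x \<in> box_of M" and y: "y \<in> box_of M" for x y
  proof -
    have nn: "0 \<le> A $ i $ j" "A $ i $ j \<le> 1" "0 \<le> p i j y" "p i j y \<le> 1" for i j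
      using A_range[of i j] p_range[of i j y] by auto
    have tm: "\<bar>A $ i $ j * p i j x * (x $ j - x $ i) - A $ i $ j * p i j y * (y $ j - y $ i)\<bar>
        \<le> (Lp i j * (2 * M) + 2) * norm (x - y)" for i j
    proof -
      have 1: "\<bar>p i j x - p i j y\<bar> \<le> Lp i j * norm (x - y)"
        using lipschitz_onD[OF Lp[of i j], of x y] by (simp add: dist_norm)
      have 2: "\<bar>x $ j - x $ i\<bar> \<le> 2 * M"
        using x by (rule box_of_diff_le)
      have 3: "\<bar>(x - y) $ j - (x - y) $ i\<bar> \<le> 2 * norm (x - y)"
        using component_le_norm_cart[of "x - y" j] component_le_norm_cart[of "x - y" i]
          abs_triangle_ineq4[of "(x - y) $ j" "(x - y) $ i"] by linarith
      \<comment> \<open>Vary the two factors of the product one at a time.\<close>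
      have "A $ i $ j * p i j x * (x $ j - x $ i) - A $ i $ j * p i j y * (y $ j - y $ i) =
        A $ i $ j * ((p i j x - p i j y) * (x $ j - x $ i) + p i j y * ((x - y) $ j - (x - y) $ i))"
        by (simp add: algebra_simps)
      also have "\<bar>\<dots>\<bar> \<le> 1 * \<bar>(p i j x - p i j y) * (x $ j - x $ i) + p i j y * ((x - y) $ j - (x - y) $ i)\<bar>"
        unfolding abs_mult[of "A $ i $ j"] using nn(1,2)[of i j] by (intro mult_right_mono) auto
      also have "\<dots> \<le> \<bar>p i j x - p i j y\<bar> * \<bar>x $ j - x $ i\<bar> + p i j y * \<bar>(x - y) $ j - (x - y) $ i\<bar>"
        using abs_triangle_ineq[of "(p i j x - p i j y) * (x $ j - x $ i)"
            "p i j y * ((x - y) $ j - (x - y) $ i)"] nn(3)[of i j]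
        by (simp only: abs_mult abs_of_nonneg mult_1)
      also have "\<dots> \<le> (Lp i j * norm (x - y)) * (2 * M) + 1 * (2 * norm (x - y))"
        using nn(3,4)[of i j] abs_ge_zero order_trans[OF abs_ge_zero 1]
        by (intro add_mono mult_mono 1 2 3) simp_all
      finally show ?thesis by (simp add: algebra_simps)
    qed
    have comp: "\<bar>(drift x - drift y) $ i\<bar> \<le> (\<Sum>j\<in>UNIV. Lp i j * (2 * M) + 2) * norm (x - y)" for i
    proof -
      have "\<bar>(drift x - drift y) $ i\<bar> = 1 / node_degree A i * \<bar>\<Sum>j\<in>UNIV.
          A $ i $ j * p i j x * (x $ j - x $ i) - A $ i $ j * p i j y * (y $ j - y $ i)\<bar>"
        using node_degree_ge_1[of i]
        by (simp add: drift_nth diff_divide_distrib[symmetric] sum_subtractf)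
      also have "\<dots> \<le> 1 * (\<Sum>j\<in>UNIV. (Lp i j * (2 * M) + 2) * norm (x - y))"
        using node_degree_ge_1[of i] tm
        by (intro mult_mono order_trans[OF sum_abs] sum_mono) auto
      finally show ?thesis by (simp add: sum_distrib_right)
    qed
    have "norm (drift x - drift y) \<le> (\<Sum>i\<in>UNIV. \<bar>(drift x - drift y) $ i\<bar>)"
      by (rule norm_le_l1_cart)
    also have "\<dots> \<le> L * norm (x - y)"
      unfolding L_def sum_distrib_right[of _ UNIV "norm (x - y)"] using comp
      by (intro sum_mono) (simp add: sum_distrib_right)
    finally show ?thesis .
  qed
  ultimately show thesis by (rule that)
qed

section \<open>Existence and uniqueness for the limiting equation\<close>

lemma ode_solution_iff:
  "ode_solution A p x0 T X \<longleftrightarrow> X \<in> extensional {0..T} \<and> X 0 = x0 \<and>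
     (\<forall>t\<in>{0..T}. (X has_vector_derivative drift (X t)) (at t within {0..T}))"
  unfolding ode_solution_def has_vector_derivative_vec_iff by (simp add: drift_nth)

lemma ode_solution_continuous:
  "ode_solution A p x0 T X \<Longrightarrow> continuous_on {0..T} X"
  unfolding ode_solution_iff by (rule continuous_on_vector_derivative[where f' = "\<lambda>t. drift (X t)"]) simp

text \<open>Two solutions are continuous on a compact interval, hence lie in a common box, where the
  drift is Lipschitz.\<close>

lemma ode_solution_unique:
  assumes "ode_solution A p x0 T X" "ode_solution A p x0 T Y"
  shows "X = Y"
proof -
  have "bounded (X ` {0..T} \<union> Y ` {0..T})"
    using assms[THEN ode_solution_continuous]
    by (simp add: compact_imp_bounded compact_continuous_image)
  then obtain M where M: "0 \<le> M" "X ` {0..T} \<union> Y ` {0..T} \<subseteq> box_of M"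
    by (rule bounded_subset_box_of)
  obtain L where L: "0 \<le> L"
    "\<And>x y. x \<in> box_of M \<Longrightarrow> y \<in> box_of M \<Longrightarrow> norm (drift x - drift y) \<le> L * norm (x - y)"
    using drift_lipschitz_on_box[OF M(1)] by metis
  note sol = assms[unfolded ode_solution_iff]
  have "X t = Y t" if t: "t \<in> {0..T}" for t
  proof (rule ode_uniqueness[where F = drift and B = "box_of M" and T = T and L = L])
    show "X t \<in> box_of M \<and> Y t \<in> box_of M" if "t \<in> {0..T}" for t using M(2) that by blast
  qed (use sol L t in simp_all)
  then show ?thesis
    using assms unfolding ode_solution_iff by (intro extensionalityI[of X "{0..T}" Y]) auto
qed

lemma ode_solution_exists:
  assumes T: "0 \<le> T"
  shows "\<exists>X. ode_solution A p x0 T X"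
proof -
  obtain M where M: "0 \<le> M" "{x0} \<subseteq> box_of M"
    using bounded_subset_box_of[of "{x0}"] by auto
  obtain L where L: "0 \<le> L"
    "\<And>x y. x \<in> box_of M \<Longrightarrow> y \<in> box_of M \<Longrightarrow> norm (drift x - drift y) \<le> L * norm (x - y)"
    using drift_lipschitz_on_box[OF M(1)] by metis
  \<comment> \<open>The drift composed with the projection \<open>c\<close> onto the box is globally Lipschitz; it points inwards
    outside of the box, so that its solution stays in the box and also solves the original equation.\<close>
  define c :: "real^'n \<Rightarrow> real^'n" where "c x = (\<chi> i. max (- M) (min M (x $ i)))" for x
  have c: "c x \<in> box_of M" for x
    using M(1) by (auto simp: c_def box_of_def abs_le_iff)
  have c_id: "c x = x" if "x \<in> box_of M" for x
  proof -
    have "max (- M) (min M (x $ i)) = x $ i" for i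
    proof -
      have "\<bar>x $ i\<bar> \<le> M" using that by (simp add: box_of_def)
      then show ?thesis by linarith
    qed
    then show ?thesis by (simp add: c_def vec_eq_iff)
  qed
  have c_nonexpansive: "norm (c x - c y) \<le> norm (x - y)" for x y
    by (rule norm_le_componentwise_cart) (auto simp: c_def)
  obtain X where X: "X 0 = x0"
    "\<And>t. t \<in> {0..T} \<Longrightarrow> (X has_vector_derivative drift (c (X t))) (at t within {0..T})"
  proof -
    have "norm (drift (c x) - drift (c y)) \<le> L * norm (x - y)" for x y
    proof -
      have "norm (drift (c x) - drift (c y)) \<le> L * norm (c x - c y)" by (intro L c)
      also have "\<dots> \<le> L * norm (x - y)"
        using L(1) c_nonexpansive by (intro mult_left_mono)
      finally show ?thesis .
    qed
    from picard_lipschitz[of T L "\<lambda>x. drift (c x)" x0, OF T L(1) this] show thesis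
      using that by blast
  qed
  have nn: "0 \<le> A $ i $ j * p i j x / node_degree A i" for i j x
    using node_degree_ge_1[of i] A_range[of i j] p_range[of i j x] by simp
  have drift_c: "drift (c x) $ i = (\<Sum>j\<in>UNIV. A $ i $ j * p i j (c x) / node_degree A i * (c x $ j - c x $ i))" for x i
    by (simp add: drift_nth sum_divide_distrib)
  \<comment> \<open>A coordinate above \<open>M\<close> is projected to \<open>M\<close>, the
    largest value in the box, so every difference in the sum is nonpositive and carries a
    nonnegative weight. The lower face is symmetric.\<close>
  have upper: "drift (c x) $ i \<le> 0" if "M < x $ i" for x i
    unfolding drift_c using nn that M(1)
    by (intro sum_nonpos mult_nonneg_nonpos) (auto simp: c_def)
  have lower: "0 \<le> drift (c x) $ i" if "x $ i < - M" for x i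
    unfolding drift_c using nn that M(1)
    by (intro sum_nonneg mult_nonneg_nonneg) (auto simp: c_def)
  have dX: "((\<lambda>s. X s $ i) has_real_derivative drift (c (X t)) $ i) (at t within {0..T})"
    if "t \<in> {0..T}" for t i
    using X(2)[OF that] by (simp add: has_vector_derivative_vec_iff)
  have inbox: "X t \<in> box_of M" if t: "t \<in> {0..T}" for t
  proof -
    have x0: "X 0 $ i \<le> M" "- X 0 $ i \<le> M" for i
      using M(2) X(1) by (simp_all add: box_of_def abs_le_iff)
    have "X t $ i \<le> M" for i
      by (rule derivative_nonpos_above_imp_bounded[OF dX upper x0(1) t])
    \<comment> \<open>The lower face: the same barrier for the negated coordinate.\<close>
    moreover have "- X t $ i \<le> M" for i
      by (rule derivative_nonpos_above_imp_bounded[OF DERIV_minus[OF dX] _ x0(2) t])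
         (simp_all add: lower)
    ultimately show ?thesis by (simp add: box_of_def abs_le_iff)
  qed
  have dX': "(X has_vector_derivative drift (X t)) (at t within {0..T})" if "t \<in> {0..T}" for t
    using X(2)[OF that] by (simp add: c_id[OF inbox[OF that]])
  \<comment> \<open>Restriction makes the solution \<open>extensional\<close>; the derivative within
    \<open>{0..T}\<close> depends only on the values kept.\<close>
  have "((\<lambda>t\<in>{0..T}. X t) has_vector_derivative drift ((\<lambda>t\<in>{0..T}. X t) t)) (at t within {0..T})"
    if t: "t \<in> {0..T}" for t
    by (rule has_vector_derivative_transform[OF t, where f = X]) (use t dX'[OF t] in auto)
  then have "ode_solution A p x0 T (\<lambda>t\<in>{0..T}. X t)"
    unfolding ode_solution_iff using X(1) T by simp
  then show ?thesis by blast
qed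

section \<open>Support and moments of the steps and of the chain\<close>

lemma finite_set_abm_step: "finite (set_pmf (abm_step A p \<mu> x))"
  unfolding abm_step_def by (auto simp: set_bind_pmf intro!: finite_UN_I)

lemma set_abm_step:
  "y \<in> set_pmf (abm_step A p \<mu> x) \<Longrightarrow> y = x \<or> (\<exists>i j. y = move i j \<mu> x)"
  unfolding abm_step_def by (auto simp: set_bind_pmf move_def split: if_splits)

lemma expectation_abm_step:
  fixes g :: "real^'n \<Rightarrow> real"
  shows "measure_pmf.expectation (abm_step A p \<mu> x) g =
    (\<Sum>i\<in>UNIV. \<Sum>j\<in>UNIV. A $ i $ j / node_degree A i *
       (p i j x * g (move i j \<mu> x) + (1 - p i j x) * g x)) / real CARD('n)"
proof -
  have pp: "0 \<le> p i j x" "p i j x \<le> 1" for i j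
    using p_range[of i j x] by auto
  have bern: "measure_pmf.expectation (bernoulli_pmf (p i j x) \<bind> (\<lambda>b. return_pmf (if b then move i j \<mu> x else x))) g
      = p i j x * g (move i j \<mu> x) + (1 - p i j x) * g x" for i j
    using pp[of i j] by (simp add: expectation_bind_finite)
  have sel: "pmf (select_pmf A i) j = A $ i $ j / node_degree A i" for i j
    using A_range A_diag by (intro pmf_select_pmf) auto
  have "measure_pmf.expectation (select_pmf A i \<bind> (\<lambda>j. bernoulli_pmf (p i j x) \<bind>
      (\<lambda>b. return_pmf (if b then move i j \<mu> x else x)))) g =
    (\<Sum>j\<in>UNIV. A $ i $ j / node_degree A i *
       (p i j x * g (move i j \<mu> x) + (1 - p i j x) * g x))" for i
    by (subst pmf_expectation_bind[of UNIV]) (simp_all add: bern sel set_bind_pmf)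
  then show ?thesis
    unfolding abm_step_def move_def[symmetric]
    by (subst pmf_expectation_bind_pmf_of_set)
       (auto simp: set_bind_pmf sum_divide_distrib field_simps)
qed

text \<open>A step moves only the chosen coordinate \<open>i\<close>, and each \<open>i\<close> has
  probability \<open>1/N\<close>; averaging over \<open>j\<close> and the success of the update
  leaves component \<open>i\<close> of the drift. For \<open>\<mu> = N h\<close> the factor becomes
  \<open>h\<close>.\<close>

lemma expectation_abm_step_increment:
  "measure_pmf.expectation (abm_step A p \<mu> x) (\<lambda>y. v \<bullet> (y - x)) = \<mu> / real CARD('n) * (v \<bullet> drift x)"
proof -
  have "(\<Sum>j\<in>UNIV. A $ i $ j / node_degree A i *
       (p i j x * (v \<bullet> (move i j \<mu> x - x)) + (1 - p i j x) * (v \<bullet> (x - x)))) =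
     \<mu> * (v $ i * drift x $ i)" for i
    by (simp add: move_diff inner_axis drift_nth sum_distrib_left mult_ac)
  then show ?thesis
    unfolding expectation_abm_step by (simp add: inner_vec_def[of v "drift x"] sum_distrib_left sum_divide_distrib)
qed

lemma abm_step_in_box_of:
  assumes "y \<in> set_pmf (abm_step A p \<mu> x)" "x \<in> box_of M" "0 \<le> M" "0 \<le> \<mu>" "\<mu> \<le> 1"
  shows "y \<in> box_of M" "norm (y - x) \<le> 2 * M * \<mu>"
  using set_abm_step[OF assms(1)] assms(2-) by (auto simp: move_in_box_of norm_move_diff)

lemma finite_set_abm_chain: "finite (set_pmf (abm_chain A p \<mu> x0 n))"
  by (induction n) (auto simp: set_bind_pmf finite_set_abm_step intro!: finite_UN_I)

text \<open>These bounds hold on every path of positive probability, so that later estimates can be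
  made path by path.\<close>

lemma set_abm_chain:
  assumes "\<omega> \<in> set_pmf (abm_chain A p \<mu> x0 n)" "x0 \<in> box_of M" "0 \<le> M" "0 \<le> \<mu>" "\<mu> \<le> 1"
  shows "\<omega> 0 = x0 \<and> (\<forall>k\<le>n. \<omega> k \<in> box_of M) \<and> (\<forall>k<n. norm (\<omega> (Suc k) - \<omega> k) \<le> 2 * M * \<mu>)"
  using assms(1)
proof (induction n arbitrary: \<omega>)
  case 0
  then show ?case using assms by simp
next
  case (Suc n)
  then obtain \<omega>' y where \<omega>': "\<omega>' \<in> set_pmf (abm_chain A p \<mu> x0 n)"
    and y: "y \<in> set_pmf (abm_step A p \<mu> (\<omega>' n))" and \<omega>: "\<omega> = fun_upd \<omega>' (Suc n) y"
    by (auto simp: set_bind_pmf)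
  have IH: "\<omega>' 0 = x0" "\<forall>k\<le>n. \<omega>' k \<in> box_of M" "\<forall>k<n. norm (\<omega>' (Suc k) - \<omega>' k) \<le> 2 * M * \<mu>"
    using Suc.IH[OF \<omega>'] by auto
  have "y \<in> box_of M" "norm (y - \<omega>' n) \<le> 2 * M * \<mu>"
    using abm_step_in_box_of[OF y _ assms(3-)] IH(2) by auto
  then show ?case using IH by (auto simp: \<omega> le_Suc_eq less_Suc_eq)
qed

text \<open>The Markov property as a tower rule: average over the last step first, given the earlier
  states.\<close>

lemma expectation_abm_chain_Suc:
  fixes g :: "(nat \<Rightarrow> real^'n) \<Rightarrow> real"
  shows "measure_pmf.expectation (abm_chain A p \<mu> x0 (Suc n)) g =
    measure_pmf.expectation (abm_chain A p \<mu> x0 n) (\<lambda>\<omega>.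
      measure_pmf.expectation (abm_step A p \<mu> (\<omega> n)) (\<lambda>y. g (fun_upd \<omega> (Suc n) y)))"
  unfolding abm_chain.simps
  by (subst expectation_bind_finite)
     (auto simp: set_bind_pmf finite_set_abm_step finite_set_abm_chain expectation_bind_finite
       intro!: finite_UN_I)

text \<open>Here \<open>x\<close> is the state of the chain, \<open>y\<close> the solution at the
  same time and \<open>d\<close> the increment of the solution over one step. In the expanded square
  the linear terms give the drift difference and the Euler remainder; the quadratic term is
  \<open>O(h\<^sup>2)\<close> because both increments are \<open>O(h)\<close>.\<close>

lemma second_moment_step:
  assumes x: "x \<in> box_of M" and y: "y \<in> box_of M" and M: "0 \<le> M"
    and h: "0 < h" "real CARD('n) * h \<le> 1"
    and lip: "norm (drift x - drift y) \<le> L * norm (x - y)"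
    and xy: "norm (x - y) \<le> R"
    and d: "norm d \<le> D * h" "norm (d - h *\<^sub>R drift y) \<le> C * h\<^sup>2"
  shows "measure_pmf.expectation (abm_step A p (real CARD('n) * h) x) (\<lambda>x'. (norm (x' - (y + d)))\<^sup>2)
    \<le> (1 + 2 * L * h) * (norm (x - y))\<^sup>2 + (2 * R * C + (2 * M * real CARD('n) + D)\<^sup>2) * h\<^sup>2"
proof -
  define \<mu> where "\<mu> = real CARD('n) * h"
  have \<mu>: "0 \<le> \<mu>" "\<mu> \<le> 1" using h by (simp_all add: \<mu>_def)
  define q where "q = abm_step A p \<mu> x"
  define u where "u = x - y"
  define E where "E = 2 * M * real CARD('n) + D"
  note fin = finite_set_abm_step[of \<mu> x, folded q_def]
  have "measure_pmf.expectation q (\<lambda>x'. (norm (x' - (y + d)))\<^sup>2) \<le>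
      measure_pmf.expectation q (\<lambda>x'. 2 * (u \<bullet> (x' - x)) + ((norm u)\<^sup>2 - 2 * (u \<bullet> d) + (E * h)\<^sup>2))"
  proof (rule expectation_mono_finite[OF fin])
    fix x' assume "x' \<in> set_pmf q"
    then have w: "norm (x' - x) \<le> 2 * M * \<mu>"
      using abm_step_in_box_of(2)[OF _ x M \<mu>] by (simp add: q_def)
    have "norm ((x' - x) - d) \<le> norm (x' - x) + norm d" by (rule norm_triangle_ineq4)
    also have "\<dots> \<le> E * h" using w d(1) by (simp add: \<mu>_def E_def algebra_simps)
    finally have "(norm ((x' - x) - d))\<^sup>2 \<le> (E * h)\<^sup>2" by (simp add: power_mono)
    moreover have "(norm (x' - (y + d)))\<^sup>2 = (norm u)\<^sup>2 + 2 * (u \<bullet> (x' - x)) - 2 * (u \<bullet> d) + (norm ((x' - x) - d))\<^sup>2"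
      unfolding u_def power2_norm_eq_inner by (simp add: algebra_simps inner_commute)
    ultimately show "(norm (x' - (y + d)))\<^sup>2 \<le> 2 * (u \<bullet> (x' - x)) + ((norm u)\<^sup>2 - 2 * (u \<bullet> d) + (E * h)\<^sup>2)"
      by simp
  qed
  also have "\<dots> = 2 * h * (u \<bullet> drift x) + ((norm u)\<^sup>2 - 2 * (u \<bullet> d) + (E * h)\<^sup>2)"
  proof -
    have "measure_pmf.expectation q (\<lambda>x'. 2 * f x' + c) = 2 * measure_pmf.expectation q f + c"
      for f :: "real^'n \<Rightarrow> real" and c
      using fin by (simp add: integrable_measure_pmf_finite)
    moreover have "measure_pmf.expectation q (\<lambda>x'. u \<bullet> (x' - x)) = h * (u \<bullet> drift x)"
      unfolding q_def expectation_abm_step_increment by (simp add: \<mu>_def)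
    ultimately show ?thesis by simp
  qed
  \<comment> \<open>Split \<open>d\<close> into \<open>h *\<^sub>R drift y\<close> and the Euler
    remainder, so that the two drifts can be compared.\<close>
  also have "\<dots> = (norm u)\<^sup>2 + 2 * h * (u \<bullet> (drift x - drift y)) + 2 * (- u \<bullet> (d - h *\<^sub>R drift y)) + (E * h)\<^sup>2"
    by (simp add: algebra_simps)
  also have "\<dots> \<le> (norm u)\<^sup>2 + 2 * h * (norm u * (L * norm u)) + 2 * (R * (C * h\<^sup>2)) + (E * h)\<^sup>2"
  proof -
    have "u \<bullet> (drift x - drift y) \<le> norm u * (L * norm u)"
      using lip by (intro order_trans[OF norm_cauchy_schwarz] mult_left_mono) (auto simp: u_def)
    moreover have "- u \<bullet> (d - h *\<^sub>R drift y) \<le> R * (C * h\<^sup>2)"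
      using d(2) xy order_trans[OF norm_ge_zero xy]
      by (intro order_trans[OF norm_cauchy_schwarz] mult_mono) (auto simp: u_def norm_minus_commute)
    ultimately show ?thesis using h by (intro add_mono mult_left_mono) auto
  qed
  also have "\<dots> = (1 + 2 * L * h) * (norm u)\<^sup>2 + (2 * R * C + E\<^sup>2) * h\<^sup>2"
    by (simp add: power2_eq_square algebra_simps)
  finally show ?thesis by (simp add: q_def \<mu>_def u_def E_def)
qed

end

section \<open>Comparison of the chain with the solution\<close>

lemma nat_floor_le: "0 < h \<Longrightarrow> 0 \<le> t \<Longrightarrow> real (nat \<lfloor>t / h\<rfloor>) * h \<le> t" for h t :: real
  using of_int_floor_le[of "t / h"] by (simp add: pos_le_divide_eq[symmetric])

lemma nat_floor_diff: "0 < h \<Longrightarrow> 0 \<le> t \<Longrightarrow> t - real (nat \<lfloor>t / h\<rfloor>) * h \<le> h" for h t :: real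
proof -
  assume "0 < h" "0 \<le> t"
  have "t / h < of_int \<lfloor>t / h\<rfloor> + 1" by linarith
  then show ?thesis using \<open>0 < h\<close> \<open>0 \<le> t\<close> by (simp add: field_simps)
qed

text \<open>One box must hold both processes for \<open>lip\<close> to apply to their difference. It
  is chosen to hold the solution, hence \<open>x0\<close>, and steps of the chain do not leave
  it.\<close>

locale abm_with_solution = abm A p
  for A :: "real^'n^'n" and p :: "'n \<Rightarrow> 'n \<Rightarrow> real^'n \<Rightarrow> real" +
  fixes x0 :: "real^'n" and T M L :: real and X :: "real \<Rightarrow> real^'n"
  assumes T: "0 \<le> T" and M: "0 \<le> M" and L: "0 \<le> L"
    and sol: "ode_solution A p x0 T X"
    and X_box: "t \<in> {0..T} \<Longrightarrow> X t \<in> box_of M"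
    and lip: "x \<in> box_of M \<Longrightarrow> y \<in> box_of M \<Longrightarrow> norm (drift x - drift y) \<le> L * norm (x - y)"
begin

text \<open>On the box the norm is at most \<open>N * M\<close> and the drift vanishes at 0, so this
  bounds the drift and thus the velocity of \<open>X\<close>.\<close>

definition speed :: real where "speed = L * (real CARD('n) * M)"

text \<open>The constant of \<open>second_moment_step\<close> for \<open>R = 2 * (N * M)\<close>,
  \<open>C = L * speed\<close> and \<open>D = speed\<close>.\<close>

definition step_const :: real where
  "step_const = 2 * (2 * (real CARD('n) * M)) * (L * speed) + (2 * M * real CARD('n) + speed)\<^sup>2"

lemma speed_nonneg: "0 \<le> speed" and step_const_nonneg: "0 \<le> step_const"
  using L M by (simp_all add: speed_def step_const_def)

lemma x0_box: "x0 \<in> box_of M"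
  using X_box[of 0] T sol by (simp add: ode_solution_iff)

lemma norm_drift_le: "x \<in> box_of M \<Longrightarrow> norm (drift x) \<le> speed"
proof -
  assume x: "x \<in> box_of M"
  have "norm (drift x) \<le> L * norm x"
    using lip[of x 0] x M by (simp add: drift_0 box_of_def)
  also have "\<dots> \<le> speed" unfolding speed_def using norm_le_box_of[OF x] L by (rule mult_left_mono)
  finally show ?thesis .
qed

lemma X_deriv:
  "t \<in> {0..T} \<Longrightarrow> S \<subseteq> {0..T} \<Longrightarrow> (X has_vector_derivative drift (X t)) (at t within S)"
  using sol unfolding ode_solution_iff by (blast intro: has_vector_derivative_within_subset)

lemma X_lipschitz:
  assumes "s \<in> {0..T}" "t \<in> {0..T}"
  shows "norm (X t - X s) \<le> speed * \<bar>t - s\<bar>"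
proof -
  have "norm (X t - X s) \<le> speed * norm (t - s)"
  proof (rule differentiable_bound[where S = "{0..T}" and f' = "\<lambda>t r. r *\<^sub>R drift (X t)"])
    fix u assume u: "u \<in> {0..T}"
    show "(X has_derivative (\<lambda>r. r *\<^sub>R drift (X u))) (at u within {0..T})"
      using X_deriv[OF u order_refl] by (simp add: has_vector_derivative_def)
    have "norm (r *\<^sub>R drift (X u)) \<le> speed * norm r" for r
      using norm_drift_le[OF X_box[OF u]] by (simp add: mult.commute[of speed] mult_left_mono)
    then show "onorm (\<lambda>r. r *\<^sub>R drift (X u)) \<le> speed" by (rule onorm_le)
  qed (use assms in auto)
  then show ?thesis by simp
qed

text \<open>Over a step \<open>X\<close> moves by at most \<open>speed * h\<close>, so its
  derivative \<open>drift (X s)\<close> varies by at most \<open>L * (speed * h)\<close>.\<close>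

lemma X_euler:
  assumes "0 \<le> t" "0 \<le> h" "t + h \<le> T"
  shows "norm (X (t + h) - X t - h *\<^sub>R drift (X t)) \<le> (L * speed) * h\<^sup>2"
proof -
  have "norm (X (t + h) - X t - (t + h - t) *\<^sub>R drift (X t)) \<le> norm (t + h - t) * (L * (speed * h))"
  proof (rule vector_differentiable_bound_linearization[where S = "{t..t+h}" and f' = "\<lambda>t. drift (X t)"])
    fix s assume s: "s \<in> {t..t+h}"
    then show "(X has_vector_derivative drift (X s)) (at s within {t..t+h})"
      using assms by (intro X_deriv) auto
    have "norm (drift (X s) - drift (X t)) \<le> L * norm (X s - X t)"
      using s assms by (intro lip X_box) auto
    also have "\<dots> \<le> L * (speed * \<bar>s - t\<bar>)" using s assms L by (intro mult_left_mono X_lipschitz) auto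
    also have "\<dots> \<le> L * (speed * h)" using s L speed_nonneg by (intro mult_left_mono) auto
    finally show "norm (drift (X s) - drift (X t)) \<le> L * (speed * h)" .
  qed (use assms in \<open>auto simp: closed_segment_eq_real_ivl\<close>)
  then show ?thesis using assms by (simp add: power2_eq_square mult_ac)
qed

section \<open>Error at the grid points\<close>

abbreviation chain :: "real \<Rightarrow> nat \<Rightarrow> (nat \<Rightarrow> real^'n) pmf" where
  "chain h n \<equiv> abm_chain A p (real CARD('n) * h) x0 n"

definition err :: "real \<Rightarrow> (nat \<Rightarrow> real^'n) \<Rightarrow> nat \<Rightarrow> real" where
  "err h \<omega> k = norm (\<omega> k - X (real k * h))"

text \<open>Discrete Gronwall: the error starts at 0, each step adds
  \<open>step_const * h\<^sup>2\<close> and amplifies what is there by at most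
  \<open>exp (2 * L * h)\<close>.\<close>

lemma second_moment_bound:
  assumes h: "0 < h" "real CARD('n) * h \<le> 1" and n: "real n * h \<le> T"
  shows "measure_pmf.expectation (chain h n) (\<lambda>\<omega>. (err h \<omega> n)\<^sup>2) \<le>
    step_const * h\<^sup>2 * real n * exp (2 * L * h * real n)"
  using n
proof (induction n)
  case 0
  then show ?case using sol by (simp add: err_def ode_solution_iff)
next
  case (Suc n)
  have nT: "real n * h \<le> T" "real n * h + h \<le> T" "0 \<le> real n * h" using Suc.prems h by (simp_all add: algebra_simps)
  define y d where "y = X (real n * h)" and "d = X (real n * h + h) - X (real n * h)"
  have y: "y \<in> box_of M" using nT by (auto simp: y_def intro: X_box)
  have d: "norm d \<le> speed * h" "norm (d - h *\<^sub>R drift y) \<le> (L * speed) * h\<^sup>2"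
    using X_lipschitz[of "real n * h" "real n * h + h"] X_euler[of "real n * h" h] nT h
    by (simp_all add: d_def y_def)
  have "measure_pmf.expectation (chain h (Suc n)) (\<lambda>\<omega>. (err h \<omega> (Suc n))\<^sup>2) =
      measure_pmf.expectation (chain h n) (\<lambda>\<omega>. measure_pmf.expectation
        (abm_step A p (real CARD('n) * h) (\<omega> n)) (\<lambda>x'. (norm (x' - (y + d)))\<^sup>2))"
    unfolding expectation_abm_chain_Suc by (simp add: err_def y_def d_def algebra_simps)
  also have "\<dots> \<le> measure_pmf.expectation (chain h n) (\<lambda>\<omega>. (1 + 2 * L * h) * (err h \<omega> n)\<^sup>2 + step_const * h\<^sup>2)"
  proof (rule expectation_mono_finite[OF finite_set_abm_chain])
    fix \<omega> assume "\<omega> \<in> set_pmf (chain h n)"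
    then have x: "\<omega> n \<in> box_of M"
      using set_abm_chain[OF _ x0_box M] h by fastforce
    have "norm (\<omega> n - y) \<le> 2 * (real CARD('n) * M)"
      using norm_triangle_ineq4[of "\<omega> n" y] norm_le_box_of[OF x] norm_le_box_of[OF y] by linarith
    from second_moment_step[OF x y M h lip[OF x y] this d]
    show "measure_pmf.expectation (abm_step A p (real CARD('n) * h) (\<omega> n)) (\<lambda>x'. (norm (x' - (y + d)))\<^sup>2)
      \<le> (1 + 2 * L * h) * (err h \<omega> n)\<^sup>2 + step_const * h\<^sup>2"
      by (simp add: step_const_def err_def y_def)
  qed
  also have "\<dots> = (1 + 2 * L * h) * measure_pmf.expectation (chain h n) (\<lambda>\<omega>. (err h \<omega> n)\<^sup>2) + step_const * h\<^sup>2"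
    by (simp add: integrable_measure_pmf_finite finite_set_abm_chain)
  \<comment> \<open>The added term is enlarged by the full exponential factor so that both summands
    carry the same one.\<close>
  also have "\<dots> \<le> exp (2 * L * h) * (step_const * h\<^sup>2 * real n * exp (2 * L * h * real n)) +
      step_const * h\<^sup>2 * exp (2 * L * h * real (Suc n))"
  proof (rule add_mono, rule mult_mono)
    show "1 + 2 * L * h \<le> exp (2 * L * h)" by (rule exp_ge_add_one_self)
    show "step_const * h\<^sup>2 \<le> step_const * h\<^sup>2 * exp (2 * L * h * real (Suc n))"
      using step_const_nonneg L h mult_left_mono[of 1 "exp (2 * L * h * real (Suc n))" "step_const * h\<^sup>2"] by simp
  qed (use Suc.IH nT in auto)
  also have "\<dots> = step_const * h\<^sup>2 * real (Suc n) * exp (2 * L * h * real (Suc n))"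
    by (simp add: exp_add[symmetric] algebra_simps)
  finally show ?case .
qed

text \<open>From \<open>second_moment_bound\<close> with \<open>n * h \<le> T\<close>: one of the
  two powers of \<open>h\<close> is absorbed by \<open>n\<close>, the other remains.\<close>

definition var_const :: real where "var_const = step_const * T * exp (2 * L * T)"

text \<open>All errors are averaged under the law of the full chain, whereas
  \<open>second_moment_bound\<close> uses the chain that ends at the time in question. The induction
  reconciles them: a further step leaves the earlier states unchanged.\<close>

lemma sum_second_moments_bound:
  assumes h: "0 < h" "real CARD('n) * h \<le> 1" and n: "real n * h \<le> T"
  shows "measure_pmf.expectation (chain h n) (\<lambda>\<omega>. \<Sum>k\<le>n. (err h \<omega> k)\<^sup>2) \<le> real (Suc n) * (var_const * h)"
  using n
proof (induction n)
  case 0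
  have "0 \<le> var_const * h" using step_const_nonneg T h by (simp add: var_const_def)
  then show ?case using sol by (simp add: err_def ode_solution_iff)
next
  case (Suc n)
  have nT: "real n * h \<le> T" using Suc.prems h by (simp add: algebra_simps)
  have fin: "finite (set_pmf (chain h (Suc n)))" by (rule finite_set_abm_chain)
  have "measure_pmf.expectation (chain h (Suc n)) (\<lambda>\<omega>. \<Sum>k\<le>Suc n. (err h \<omega> k)\<^sup>2) =
     measure_pmf.expectation (chain h (Suc n)) (\<lambda>\<omega>. \<Sum>k\<le>n. (err h \<omega> k)\<^sup>2) +
     measure_pmf.expectation (chain h (Suc n)) (\<lambda>\<omega>. (err h \<omega> (Suc n))\<^sup>2)"
    using fin by (simp add: integrable_measure_pmf_finite del: abm_chain.simps)
  also have "measure_pmf.expectation (chain h (Suc n)) (\<lambda>\<omega>. \<Sum>k\<le>n. (err h \<omega> k)\<^sup>2) =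
     measure_pmf.expectation (chain h n) (\<lambda>\<omega>. \<Sum>k\<le>n. (err h \<omega> k)\<^sup>2)"
    unfolding expectation_abm_chain_Suc by (simp add: err_def)
  also have "\<dots> \<le> real (Suc n) * (var_const * h)" by (rule Suc.IH[OF nT])
  also have "measure_pmf.expectation (chain h (Suc n)) (\<lambda>\<omega>. (err h \<omega> (Suc n))\<^sup>2) \<le> var_const * h"
  proof -
    have "2 * L * h * real (Suc n) \<le> 2 * L * T"
      using mult_left_mono[OF Suc.prems, of "2 * L"] L by (simp add: mult_ac)
    then have "(step_const * h) * (real (Suc n) * h) * exp (2 * L * h * real (Suc n)) \<le> (step_const * h) * T * exp (2 * L * T)"
      using Suc.prems step_const_nonneg h T by (intro mult_mono) auto
    then show ?thesis
      using second_moment_bound[OF h Suc.prems] by (simp add: var_const_def power2_eq_square mult_ac)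
  qed
  finally show ?case by (simp add: algebra_simps)
qed

text \<open>The error changes per step by at most the move of the chain plus that of the solution;
  these are the two summands, per unit of \<open>h\<close>.\<close>

definition err_rate :: real where "err_rate = 2 * M * real CARD('n) + speed"

lemma err_cube_le:
  assumes \<omega>: "\<omega> \<in> set_pmf (chain h n)" and h: "0 < h" "real CARD('n) * h \<le> 1"
    and n: "real n * h \<le> T" and m: "m \<le> n"
  shows "err h \<omega> m ^ 3 \<le> 3 * (err_rate * h) * (\<Sum>k\<le>n. (err h \<omega> k)\<^sup>2)"
proof (rule cube_le_sum_squares[OF _ _ _ _ m])
  have path: "\<omega> 0 = x0" "\<And>k. k < n \<Longrightarrow> norm (\<omega> (Suc k) - \<omega> k) \<le> 2 * M * (real CARD('n) * h)"
    using set_abm_chain[OF \<omega> x0_box M] h by auto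
  show "err h \<omega> 0 = 0" using path(1) sol by (simp add: err_def ode_solution_iff)
  show "0 \<le> err h \<omega> k" for k by (simp add: err_def)
  show "0 \<le> err_rate * h" using M speed_nonneg h by (simp add: err_rate_def)
  fix k assume k: "k < n"
  have "real (Suc k) * h \<le> real n * h" using k h by (intro mult_right_mono) auto
  then have kT: "real (Suc k) * h \<in> {0..T}" "real k * h \<in> {0..T}"
    using n h by (auto simp: algebra_simps)
  have "\<omega> (Suc k) - X (real (Suc k) * h) = (\<omega> k - X (real k * h)) + (\<omega> (Suc k) - \<omega> k)
      - (X (real (Suc k) * h) - X (real k * h))"
    by simp
  also have "norm \<dots> \<le> norm (\<omega> k - X (real k * h)) + norm (\<omega> (Suc k) - \<omega> k)
      + norm (X (real (Suc k) * h) - X (real k * h))"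
    by (rule order_trans[OF norm_triangle_ineq4 add_right_mono[OF norm_triangle_ineq]])
  also have "\<dots> \<le> err h \<omega> k + 2 * M * (real CARD('n) * h) + speed * h"
    using path(2)[OF k] X_lipschitz[OF kT(2,1)] h
    by (intro add_mono) (auto simp: err_def algebra_simps)
  finally show "err h \<omega> (Suc k) \<le> err h \<omega> k + err_rate * h"
    by (simp add: err_def err_rate_def algebra_simps)
qed

section \<open>From grid errors to convergence in distribution\<close>

lemma X_in_skorokhod_space: "X \<in> skorokhod_space T"
  using sol ode_solution_continuous[OF sol]
  by (auto simp: ode_solution_iff intro: continuous_in_skorokhod_space)

text \<open>Between grid points the trajectory is frozen while \<open>X\<close> moves on, by at most
  \<open>speed * h\<close>.\<close>

lemma skorokhod_dist_trajectory:
  assumes h: "0 < h" and \<delta>: "0 < \<delta>" and err: "\<And>k. k \<le> nat \<lfloor>T / h\<rfloor> \<Longrightarrow> err h \<omega> k \<le> \<delta>"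
  shows "skorokhod_dist T X (trajectory h T \<omega>) \<le> \<delta> + speed * h"
proof (rule skorokhod_dist_le_uniform)
  show "X \<in> skorokhod_space T" by (rule X_in_skorokhod_space)
  show "trajectory h T \<omega> \<in> skorokhod_space T" using h by (rule trajectory_in_skorokhod_space)
  show "0 < \<delta> + speed * h" using h \<delta> speed_nonneg by (simp add: add_pos_nonneg)
  fix t assume t: "t \<in> {0..T}"
  define k where "k = nat \<lfloor>t / h\<rfloor>"
  have k: "real k * h \<le> t" "t - real k * h \<le> h"
    using nat_floor_le[of h t] nat_floor_diff[of h t] t h by (auto simp: k_def)
  have "k \<le> nat \<lfloor>T / h\<rfloor>"
    unfolding k_def using t h by (intro nat_mono floor_mono divide_right_mono) auto
  then have "norm (\<omega> k - X (real k * h)) \<le> \<delta>" using err by (simp add: err_def)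
  moreover have "norm (X t - X (real k * h)) \<le> speed * \<bar>t - real k * h\<bar>"
    using t k h by (intro X_lipschitz) auto
  moreover have "speed * \<bar>t - real k * h\<bar> \<le> speed * h" using k speed_nonneg by (intro mult_left_mono) auto
  moreover have "dist (X t) (trajectory h T \<omega> t) \<le> norm (\<omega> k - X (real k * h)) + norm (X t - X (real k * h))"
    using t dist_triangle[of "X t" "\<omega> k" "X (real k * h)"]
    by (simp add: trajectory_def k_def dist_norm norm_minus_commute)
  ultimately show "dist (X t) (trajectory h T \<omega> t) \<le> \<delta> + speed * h" by linarith
qed

lemma abm_law_converges:
  "converges_in_distribution (skorokhod_topology T)
     (\<lambda>h. abm_law A p (real CARD('n) * h) x0 T h) (return_pmf X) (at_right 0)"
  unfolding converges_in_distribution_def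
proof (intro allI impI, elim conjE)
  fix f :: "(real \<Rightarrow> real^'n) \<Rightarrow> real"
  assume cont: "continuous_map (skorokhod_topology T) euclideanreal f"
    and "bounded (f ` topspace (skorokhod_topology T))"
  then obtain B where B: "0 < B" "\<And>g. g \<in> skorokhod_space T \<Longrightarrow> \<bar>f g\<bar> \<le> B"
    by (auto simp: bounded_pos)
  have "((\<lambda>h. measure_pmf.expectation (abm_law A p (real CARD('n) * h) x0 T h) f) \<longlongrightarrow> f X) (at_right 0)"
  proof (rule tendstoI)
    fix e :: real assume e: "0 < e"
    obtain r where r: "0 < r"
      "\<And>g. g \<in> skorokhod_space T \<Longrightarrow> skorokhod_dist T X g < r \<Longrightarrow> \<bar>f g - f X\<bar> < e / 2"
      using continuous_map_skorokhodD[OF cont X_in_skorokhod_space, of "e / 2"] e by auto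
    \<comment> \<open>The other half of \<open>r\<close> is reserved for
      \<open>speed * h\<close>.\<close>
    define \<delta> where "\<delta> = r / 2"
    have \<delta>: "0 < \<delta>" using r by (simp add: \<delta>_def)
    \<comment> \<open>Markov's inequality done pathwise: if some error exceeds
      \<open>\<delta>\<close>, then \<open>err_cube_le\<close> gives
      \<open>1 \<le> 3 * (err_rate * h) * S \<omega> / \<delta> ^ 3\<close>. Multiplied by
      \<open>2 * B\<close>, the trivial bound on the difference of the values of \<open>f\<close>,
      this becomes \<open>Q * h * S \<omega>\<close>.\<close>
    define Q where "Q = 2 * B * (3 * err_rate) / \<delta> ^ 3"
    have err_rate: "0 \<le> err_rate" using M speed_nonneg by (simp add: err_rate_def)
    have Q: "0 \<le> Q" using B \<delta> err_rate by (simp add: Q_def)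
    have var_const: "0 \<le> var_const" using step_const_nonneg T by (simp add: var_const_def)
    have bound: "\<bar>measure_pmf.expectation (abm_law A p (real CARD('n) * h) x0 T h) f - f X\<bar>
        \<le> e / 2 + Q * h * (var_const * (T + h))"
      if h: "0 < h" "real CARD('n) * h \<le> 1" "speed * h < r / 2" for h
    proof -
      define n where "n = nat \<lfloor>T / h\<rfloor>"
      have n: "real n * h \<le> T" unfolding n_def using h T by (intro nat_floor_le) auto
      note fin = finite_set_abm_chain[of "real CARD('n) * h" x0 n]
      define S where "S \<omega> = (\<Sum>k\<le>n. (err h \<omega> k)\<^sup>2)" for \<omega>
      have S0: "0 \<le> S \<omega>" for \<omega> by (simp add: S_def sum_nonneg)
      have pw: "\<bar>f (trajectory h T \<omega>) - f X\<bar> \<le> e / 2 + Q * h * S \<omega>"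
        if \<omega>: "\<omega> \<in> set_pmf (chain h n)" for \<omega>
      proof (cases "\<forall>k\<le>n. err h \<omega> k \<le> \<delta>")
        case True
        then have "skorokhod_dist T X (trajectory h T \<omega>) \<le> \<delta> + speed * h"
          using h \<delta> by (intro skorokhod_dist_trajectory) (auto simp: n_def)
        then have "\<bar>f (trajectory h T \<omega>) - f X\<bar> < e / 2"
          using h by (intro r trajectory_in_skorokhod_space) (auto simp: \<delta>_def)
        moreover have "0 \<le> Q * h * S \<omega>" using Q h S0 by simp
        ultimately show ?thesis by simp
      next
        case False
        then obtain m where m: "m \<le> n" "\<delta> < err h \<omega> m" by auto
        have "\<delta> ^ 3 \<le> err h \<omega> m ^ 3" using m \<delta> by (intro power_mono) auto
        also have "\<dots> \<le> 3 * (err_rate * h) * S \<omega>"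
          unfolding S_def by (rule err_cube_le[OF \<omega> h(1,2) n m(1)])
        finally have "2 * B * 1 \<le> 2 * B * (3 * (err_rate * h) * S \<omega> / \<delta> ^ 3)"
          using B \<delta> by (intro mult_left_mono) (auto simp: le_divide_eq)
        then have "2 * B \<le> Q * h * S \<omega>" by (simp add: Q_def mult_ac)
        moreover have "\<bar>f (trajectory h T \<omega>)\<bar> \<le> B" "\<bar>f X\<bar> \<le> B"
          using h by (auto intro!: B trajectory_in_skorokhod_space X_in_skorokhod_space)
        ultimately show ?thesis using e by linarith
      qed
      have "measure_pmf.expectation (abm_law A p (real CARD('n) * h) x0 T h) f - f X =
          measure_pmf.expectation (chain h n) (\<lambda>\<omega>. f (trajectory h T \<omega>) - f X)"
        using fin by (simp add: abm_law_def n_def integrable_measure_pmf_finite)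
      also have "\<bar>\<dots>\<bar> \<le> measure_pmf.expectation (chain h n) (\<lambda>\<omega>. \<bar>f (trajectory h T \<omega>) - f X\<bar>)"
        by (rule integral_abs_bound)
      also have "\<dots> \<le> measure_pmf.expectation (chain h n) (\<lambda>\<omega>. e / 2 + Q * h * S \<omega>)"
        using pw by (rule expectation_mono_finite[OF fin])
      also have "\<dots> = e / 2 + Q * h * measure_pmf.expectation (chain h n) S"
        using fin by (simp add: integrable_measure_pmf_finite)
      also have "\<dots> \<le> e / 2 + Q * h * (real (Suc n) * (var_const * h))"
        using sum_second_moments_bound[OF h(1,2) n] Q h
        by (intro add_left_mono mult_left_mono) (auto simp: S_def[abs_def])
      \<comment> \<open>About \<open>T / h\<close> terms of size \<open>O(h)\<close> have a bounded
        sum, so the prefactor \<open>Q * h\<close> makes the whole contribution vanish in the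
        limit.\<close>
      also have "real (Suc n) * (var_const * h) = var_const * (real n * h + h)" by (simp add: algebra_simps)
      also have "e / 2 + Q * h * (var_const * (real n * h + h)) \<le> e / 2 + Q * h * (var_const * (T + h))"
        using n Q var_const h by (intro add_left_mono mult_left_mono) auto
      finally show ?thesis .
    qed
    have lim: "((\<lambda>h::real. real CARD('n) * h) \<longlongrightarrow> real CARD('n) * 0) (at_right 0)"
      "((\<lambda>h. speed * h) \<longlongrightarrow> speed * 0) (at_right 0)"
      "((\<lambda>h. e / 2 + Q * h * (var_const * (T + h))) \<longlongrightarrow> e / 2 + Q * 0 * (var_const * (T + 0))) (at_right 0)"
      by (intro tendsto_intros)+
    have "eventually (\<lambda>h::real. real CARD('n) * h < 1) (at_right 0)"
      "eventually (\<lambda>h. speed * h < r / 2) (at_right 0)"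
      "eventually (\<lambda>h. e / 2 + Q * h * (var_const * (T + h)) < e) (at_right 0)"
      using order_tendstoD(2)[OF lim(1), of 1] order_tendstoD(2)[OF lim(2), of "r / 2"]
        order_tendstoD(2)[OF lim(3), of e] r(1) e by simp_all
    then show "eventually (\<lambda>h. dist (measure_pmf.expectation
        (abm_law A p (real CARD('n) * h) x0 T h) f) (f X) < e) (at_right 0)"
      using eventually_at_right_less[of "0 :: real"]
    proof eventually_elim
      case (elim h)
      then show ?case using bound[of h] by (simp add: dist_real_def)
    qed
  qed
  then show "((\<lambda>h. measure_pmf.expectation (abm_law A p (real CARD('n) * h) x0 T h) f)
      \<longlongrightarrow> measure_pmf.expectation (return_pmf X) f) (at_right 0)"
    by simp
qed

end

theorem mainTheorem3:
  fixes A :: "real^'n^'n"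
    and p :: "'n \<Rightarrow> 'n \<Rightarrow> real^'n \<Rightarrow> real"
    and x0 :: "real^'n"
    and T :: real
  assumes "0 \<le> T"
    and "\<And>i j x. p i j x \<in> {0..1}"
    and "\<And>i j. \<exists>L. L-lipschitz_on UNIV (p i j)"
    and "\<And>i j. A $ i $ j \<in> {0..1}"
    and "\<And>i. A $ i $ i = 1"
  shows "(\<exists>!X. ode_solution A p x0 T X) \<and>
    (\<forall>X. ode_solution A p x0 T X \<longrightarrow>
       converges_in_distribution (skorokhod_topology T)
         (\<lambda>h. abm_law A p (real CARD('n) * h) x0 T h) (return_pmf X) (at_right 0))"
proof (intro conjI allI impI)
  interpret abm A p using assms by unfold_locales
  show "\<exists>!X. ode_solution A p x0 T X"
    using ode_solution_exists[OF assms(1)] ode_solution_unique by blast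
  fix X assume sol: "ode_solution A p x0 T X"
  \<comment> \<open>The box is read off from the given solution, whose image is compact; at time 0
    it also captures the start of the chain.\<close>
  have "bounded (X ` {0..T})"
    using ode_solution_continuous[OF sol] by (simp add: compact_imp_bounded compact_continuous_image)
  then obtain M where M: "0 \<le> M" "X ` {0..T} \<subseteq> box_of M"
    by (rule bounded_subset_box_of)
  obtain L where L: "0 \<le> L"
    "\<And>x y. x \<in> box_of M \<Longrightarrow> y \<in> box_of M \<Longrightarrow> norm (drift x - drift y) \<le> L * norm (x - y)"
    using drift_lipschitz_on_box[OF M(1)] by metis
  interpret abm_with_solution A p x0 T M L X
    using assms(1) sol M L by unfold_locales auto
  show "converges_in_distribution (skorokhod_topology T)
         (\<lambda>h. abm_law A p (real CARD('n) * h) x0 T h) (return_pmf X) (at_right 0)"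
    by (rule abm_law_converges)
qed

end
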